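(* Let $n\ge2$ and let $P=P_{\mathcal{C}_{A_{n-1}}}(A_{n-1})$ be the maximal permutonestohedron of type $A_{n-1}$ (constructed with any suitable list). For every $0\le k\le n-2$, the number of faces of $P$ of codimension $k+1$ is \[\sum_{\lambda\in\Lambda_n,\ l(\lambda)\ge2+k}w(\lambda)\,\frac{n!}{\lambda_1!\lambda_2!\cdots\lambda_{l(\lambda)}!}\left[\sum_{1<j_1<\dots<j_k<l(\lambda)=j_{k+1}}\ \prod_{i=1}^{k}\binom{j_{i+1}-1}{j_i-1}\right],\] where the inner sum ranges over all integer sequences $1<j_1<\dots<j_k<l(\lambda)$, with $j_{k+1}:=l(\lambda)$ (for $k=0$ the inner sum equals $1$).
   Context: Root system $A_{n-1}$: $V=\{x\in\mathbb{R}^n:\sum x_i=0\}$ (dimension $N=n-1$), $\Phi=\{e_i-e_j:i\ne j\}$, $W=S_n$, simple roots $\alpha_i=e_i-e_{i+1}$, positive roots $\{e_i-e_j:i<j\}$. $\mathcal{C}_{A_{n-1}}$ is the maximal building set: all subspaces spanned by nonempty subsets of $\Phi$. Permutonestohedron for a root system $\Phi$ spanning a Euclidean space $V$ of dimension $N$ with simple roots $\Delta$ and a $W$-invariant building set $\mathcal{G}$ containing $V$ (building set: $\mathcal{G}$ consists of subspaces spanned by roots, contains all lines $\langle\alpha\rangle$, and every subspace $C$ spanned by roots is the direct sum of the maximal elements of $\mathcal{G}$ contained in $C$): let $\pi_A=\frac12\sum_{\alpha\in\Phi^+\cap A}\alpha$, $\delta=\pi_V$, $\delta_A=\delta-\pi_A$;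 $\mathcal{G}_{fund}$ = elements of $\mathcal{G}$ spanned by subsets of $\Delta$, $\mathcal{C}_{fund}$ = subspaces spanned by nonempty subsets of $\Delta$. For $B\subsetneq A$ in $\mathcal{G}_{fund}$, $R^A_B=p/q$ ($p$ max coefficient of $\pi_A$, $q$ min coefficient of $\pi_B$ over simple roots in $B$), $R^i_j=\max R^A_B$ over $\dim A=i,\dim B=j$; a suitable list is $0<\epsilon_1<\dots<\epsilon_N=a$ with $\epsilon_i>2R^i_{i-1}\epsilon_{i-1}$. $HS_V=\{(x,\delta)\le a\}$, $HS_A=\{(x,\delta_A)\le a-\epsilon_{\dim A}\}$ ($A\in\mathcal{G}_{fund}\setminus\{V\}$); for $C\in\mathcal{C}_{fund}\setminus\mathcal{G}_{fund}$ with decomposition $C=C_1\oplus\dots\oplus C_r$ into maximal elements of $\mathcal{G}_{fund}$ in $C$, $\overline{HS}_C$ is the closed half-space bounded by $\{(x,\delta-\sum\pi_{C_i})=a-\sum\epsilon_{\dim C_i}\}$ containing the origin. $P_{\mathcal{G}}(\Phi)=\bigcap_{\sigma\in W}\big(\bigcap_{A\in\mathcal{G}_{fund}}\sigma HS_A\cap\bigcap_{C\in\mathcal{C}_{fund}\setminus\mathcal{G}_{fund}}\sigma\overline{HS}_C\big)$, an $N$-dimensional polytope. Partitions: $\Lambda_n$ is the set of partitions $\lambda=(\lambda_1,\dots,\lambda_{l(\lambda)})$ of $n$, $l(\lambda)$ its number of parts; writing $\lambda=\prod_i i^{m_i}$, $w(\lambda)=l(\lambda)!/\prod_i m_i!$.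 *)

theory Defs
  imports "HOL-Analysis.Analysis"
begin

section \<open>Permutonestohedra\<close>

text \<open>The data of a root system in a Euclidean space: the space \<open>V\<close> it spans (which may be a proper
  subspace of the ambient type), roots \<open>\<Phi>\<close>, positive roots \<open>\<Phi>p\<close>, simple roots \<open>\<Delta>\<close>, and the Weyl
  group \<open>W\<close>, given by its action. The locale imposes no axioms, so the definitions are
  unconditional; they are meaningful for actual root systems.\<close>

locale root_datum =
  fixes V \<Phi> \<Phi>p \<Delta> :: "'a::euclidean_space set" and W :: "('a \<Rightarrow> 'a) set"
begin

text \<open>The maximal building set.\<close>

definition max_building_set :: "'a set set" where
  "max_building_set = {span S | S. S \<subseteq> \<Phi> \<and> S \<noteq> {}}"

definition pi_sum :: "'a set \<Rightarrow> 'a" where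
  "pi_sum A = (1/2) *\<^sub>R (\<Sum>\<alpha>\<in>\<Phi>p \<inter> A. \<alpha>)"

definition \<delta> :: 'a where
  "\<delta> = pi_sum V"

definition \<delta>_sub :: "'a set \<Rightarrow> 'a" where
  "\<delta>_sub A = \<delta> - pi_sum A"

definition G_fund :: "'a set set \<Rightarrow> 'a set set" where
  "G_fund G = {A \<in> G. \<exists>S\<subseteq>\<Delta>. A = span S}"

definition C_fund :: "'a set set" where
  "C_fund = {span S | S. S \<subseteq> \<Delta> \<and> S \<noteq> {}}"

text \<open>The number $R^A_B$; coefficients are taken with respect to the basis \<open>\<Delta>\<close> of \<open>V\<close>.\<close>

definition R_pair :: "'a set \<Rightarrow> 'a set \<Rightarrow> real" where
  "R_pair A B =
     Max (representation \<Delta> (pi_sum A) ` \<Delta>) / Min (representation \<Delta> (pi_sum B) ` (\<Delta> \<inter> B))"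

text \<open>The number $R^i_j$. It is unspecified when there is no pair of these dimensions; for the
  maximal building set such pairs exist whenever \<open>1 \<le> j < i \<le> dim V\<close>.\<close>

definition R_dim :: "'a set set \<Rightarrow> nat \<Rightarrow> nat \<Rightarrow> real" where
  "R_dim G i j =
     Max {R_pair A B | A B. A \<in> G_fund G \<and> B \<in> G_fund G \<and> B \<subset> A \<and> dim A = i \<and> dim B = j}"

text \<open>Only the values \<open>\<epsilon> 1, \<dots>, \<epsilon> (dim V)\<close> matter.\<close>

definition suitable_list :: "'a set set \<Rightarrow> (nat \<Rightarrow> real) \<Rightarrow> real \<Rightarrow> bool" where
  "suitable_list G \<epsilon> a \<longleftrightarrow>
     0 < \<epsilon> 1 \<and> \<epsilon> (dim V) = a \<and>
     (\<forall>i\<in>{2..dim V}. \<epsilon> (i - 1) < \<epsilon> i \<and> \<epsilon> i > 2 * R_dim G i (i - 1) * \<epsilon> (i - 1))"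

definition HS :: "(nat \<Rightarrow> real) \<Rightarrow> real \<Rightarrow> 'a set \<Rightarrow> 'a set" where
  "HS \<epsilon> a A =
     (if A = V then {x \<in> V. x \<bullet> \<delta> \<le> a}
      else {x \<in> V. x \<bullet> \<delta>_sub A \<le> a - \<epsilon> (dim A)})"

definition max_elements_in :: "'a set set \<Rightarrow> 'a set \<Rightarrow> 'a set set" where
  "max_elements_in G C =
     {A \<in> G_fund G. A \<subseteq> C \<and> (\<forall>B\<in>G_fund G. A \<subseteq> B \<and> B \<subseteq> C \<longrightarrow> B = A)}"

text \<open>The closed half-space of \<open>V\<close> on the origin's side of the hyperplane \<open>x \<bullet> v = c\<close>.\<close>

definition HS_bar :: "'a set set \<Rightarrow> (nat \<Rightarrow> real) \<Rightarrow> real \<Rightarrow> 'a set \<Rightarrow> 'a set" where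
  "HS_bar G \<epsilon> a C =
     (let v = \<delta> - (\<Sum>A\<in>max_elements_in G C. pi_sum A);
          c = a - (\<Sum>A\<in>max_elements_in G C. \<epsilon> (dim A))
      in if 0 \<le> c then {x \<in> V. x \<bullet> v \<le> c} else {x \<in> V. x \<bullet> v \<ge> c})"

definition permutonestohedron :: "'a set set \<Rightarrow> (nat \<Rightarrow> real) \<Rightarrow> real \<Rightarrow> 'a set" where
  "permutonestohedron G \<epsilon> a =
     (\<Inter>\<sigma>\<in>W. (\<Inter>A\<in>G_fund G. \<sigma> ` HS \<epsilon> a A) \<inter> (\<Inter>C\<in>C_fund - G_fund G. \<sigma> ` HS_bar G \<epsilon> a C))"

end

section \<open>The root system of type A\<close>

text \<open>Coordinates of $\mathbb{R}^n$ are indexed by a finite linearly ordered type \<open>'n\<close> with \<open>n\<close>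
  elements, in place of \<open>{1, \<dots>, n}\<close>; the resulting root system has type $A_{n-1}$.\<close>

definition A_space :: "(real ^ 'n::{finite,linorder}) set" where
  "A_space = {x. (\<Sum>i\<in>UNIV. x $ i) = 0}"

definition A_roots :: "(real ^ 'n::{finite,linorder}) set" where
  "A_roots = {axis i 1 - axis j 1 | i j. i \<noteq> j}"

definition A_pos_roots :: "(real ^ 'n::{finite,linorder}) set" where
  "A_pos_roots = {axis i 1 - axis j 1 | i j. i < j}"

text \<open>Simple roots come from pairs of consecutive indices.\<close>

definition A_simple_roots :: "(real ^ 'n::{finite,linorder}) set" where
  "A_simple_roots = {axis i 1 - axis j 1 | i j. i < j \<and> \<not> (\<exists>k. i < k \<and> k < j)}"

text \<open>The symmetric group, permuting coordinates: \<open>p\<close> sends \<open>axis i 1\<close> to \<open>axis (p i) 1\<close>.\<close>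

definition A_weyl :: "(real ^ 'n::{finite,linorder} \<Rightarrow> real ^ 'n::{finite,linorder}) set" where
  "A_weyl = {\<lambda>x. \<chi> i. x $ (inv p i) | p. bij p}"

global_interpretation type_A: root_datum A_space A_roots A_pos_roots A_simple_roots A_weyl
  defines A_max_building_set = type_A.max_building_set
    and A_pi_sum = type_A.pi_sum
    and A_delta = type_A.\<delta>
    and A_delta_sub = type_A.\<delta>_sub
    and A_G_fund = type_A.G_fund
    and A_C_fund = type_A.C_fund
    and A_R_pair = type_A.R_pair
    and A_R_dim = type_A.R_dim
    and A_suitable_list = type_A.suitable_list
    and A_HS = type_A.HS
    and A_max_elements_in = type_A.max_elements_in
    and A_HS_bar = type_A.HS_bar
    and A_permutonestohedron = type_A.permutonestohedron .

section \<open>Faces and partitions\<close>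

text \<open>Faces are taken in the sense of \<^const>\<open>face_of\<close>; since the empty set has affine dimension -1,
  it has codimension \<open>aff_dim P + 1\<close>.\<close>

definition faces_of_codim :: "'a::euclidean_space set \<Rightarrow> nat \<Rightarrow> 'a set set" where
  "faces_of_codim P c = {F. F face_of P \<and> aff_dim P - aff_dim F = int c}"

definition partitions :: "nat \<Rightarrow> nat list set" where
  "partitions n = {\<mu>. sorted_wrt (\<ge>) \<mu> \<and> (\<forall>i\<in>set \<mu>. 0 < i) \<and> sum_list \<mu> = n}"

text \<open>The multiplicity of the part \<open>i\<close> is \<open>count_list \<mu> i\<close>.\<close>

definition part_weight :: "nat list \<Rightarrow> real" where
  "part_weight \<mu> = fact (length \<mu>) / (\<Prod>i\<in>set \<mu>. fact (count_list \<mu> i))"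

text \<open>The lists $[j_1, \dots, j_k]$ with $1 < j_1 < \dots < j_k < l$.\<close>

definition index_seqs :: "nat \<Rightarrow> nat \<Rightarrow> nat list set" where
  "index_seqs k l = {js. length js = k \<and> sorted_wrt (<) js \<and> set js \<subseteq> {1<..<l}}"

end

theory Submission
  imports Defs "HOL-Combinatorics.Multiset_Permutations"
begin

text \<open>With \<open>\<epsilon> 0 = 0\<close>, the permutonestohedron is cut out by one inequality for every nonempty chain \<open>C\<close>
  of nonempty proper subsets of the index set: half the sum of \<open>x $ i - x $ j\<close> over all pairs \<open>(i, j)\<close>
  separated by \<open>C\<close> is at most \<open>a - \<epsilon> (n - 1 - card C)\<close>. Indeed the simple roots that do \<^emph>\<open>not\<close> span \<open>A\<close>
  are the cut points of an ordered set partition, and the Weyl group permutes the labels. The polytope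
  is simple: its nonempty faces correspond to flags, i.e. chains (under inclusion) of such chains.

  If two inequalities are tight at a point, sort the coordinates of that point. The growth condition
  makes consecutive coordinates differ strictly at the cut points, and a submodularity estimate shows
  that the two sets of cut points are comparable. Conversely, for a complete flag the tight equations
  form a triangular system in the coordinate gaps, whose solution is positive and violates
  no inequality, again by the growth condition; moving it slightly along a solution of the system
  with right-hand side 0 on a subflag and -1 off it makes exactly the subflag tight. The strict descent of dimension along a
  complete flag then determines the codimension of each face. Finally, both the chains \<open>C\<close> and the flags below a chain
  are counted by the number of chains of nonempty proper subsets of a finite set.\<close>

section \<open>Counting flags\<close>

text \<open>The obstacle is ties. A boundary point may have equal coordinates, so its sorted
  enumeration is not unique, and two tight chains need not come from the same one. Strict descent at
  the cut points repairs this: every member of a tight chain is an initial segment of every sorted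
  enumeration, so comparing chains becomes comparing subsets of {1, ..., n - 1}. In gap coordinates
  the estimates rest on one count: outside the cut set D a coefficient lies between 1 and the
  integer part of (n - card D)^2 / 4. The lower bound gives the systems of complete flags a nonzero
  diagonal. The upper bound comes from a product of two block lengths with sum at most n - card D;
  for card D = n - 1 - i it is the constant of the growth condition. The convention \<eta> 0 = 0
  serves the half-space of V. Complementation turns the simple roots spanning A into cut points, but
  V would get none. Its inequality (x, \<delta>) \<le> a is instead the one with all cut points,
  with bound a - \<eta> 0.\<close>

definition chains_in :: "'a set \<Rightarrow> nat \<Rightarrow> 'a set set set" where
  "chains_in X k = {f. f \<subseteq> Pow X - {{}, X} \<and> (\<forall>A\<in>f. \<forall>B\<in>f. A \<subseteq> B \<or> B \<subseteq> A) \<and> card f = k}"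

text \<open>The recursion runs over the size \<open>j\<close> of the largest member. A chain of
  nonempty proper subsets is an ordered set partition, so for positive \<open>m\<close> this is the
  number of surjections from \<open>m\<close> onto \<open>k + 1\<close> elements.\<close>

fun chain_count :: "nat \<Rightarrow> nat \<Rightarrow> nat" where
  "chain_count m 0 = 1"
| "chain_count m (Suc k) = (\<Sum>j\<in>{1..<m}. (m choose j) * chain_count j k)"

lemma chain_count_eq_0: "1 \<le> m \<Longrightarrow> m \<le> k \<Longrightarrow> chain_count m k = 0"
  by (induction k arbitrary: m) auto

lemma finite_chains_in: "finite X \<Longrightarrow> finite (chains_in X k)"
  by (rule finite_subset[of _ "Pow (Pow X)"]) (auto simp: chains_in_def)

lemma Union_chain_in:
  assumes "finite f" "f \<noteq> {}" "\<forall>A\<in>f. \<forall>B\<in>f. A \<subseteq> B \<or> B \<subseteq> A"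
  shows "\<Union>f \<in> f"
  using assms
proof (induction f rule: finite_ne_induct)
  case (insert A f)
  then have "\<Union>f \<in> f" by blast
  then have "A \<subseteq> \<Union>f \<or> \<Union>f \<subseteq> A" using insert.prems by blast
  then show ?case using \<open>\<Union>f \<in> f\<close> by (auto simp: Un_absorb1 Un_absorb2)
qed auto

text \<open>Splitting off the largest member \<open>A\<close> leaves \<open>k\<close> nonempty
  proper subsets of \<open>A\<close>, and closure under nonempty subsets keeps them in
  \<open>S\<close>. The abstract \<open>S\<close> serves two purposes: with the nonempty proper
  subsets of a set it yields the recursion of \<open>chain_count\<close>, and with
  \<open>set_chains\<close> it counts flags, whose members are themselves chains.\<close>

lemma card_flags_Suc:
  assumes S: "finite S" "\<And>A. A \<in> S \<Longrightarrow> finite A" "{} \<notin> S"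
    and down: "\<And>A B. B \<in> S \<Longrightarrow> A \<subseteq> B \<Longrightarrow> A \<noteq> {} \<Longrightarrow> A \<in> S"
  shows "card {f. f \<subseteq> S \<and> (\<forall>A\<in>f. \<forall>B\<in>f. A \<subseteq> B \<or> B \<subseteq> A) \<and> card f = Suc k} = (\<Sum>A\<in>S. card (chains_in A k))"
    (is "card ?F = _")
proof -
  let ?T = "SIGMA A:S. chains_in A k"
  have "bij_betw (\<lambda>(A, g). insert A g) ?T ?F"
  proof (rule bij_betw_byWitness[where f' = "\<lambda>f. (\<Union>f, f - {\<Union>f})"])
    have U: "\<Union>(insert A g) = A" "A \<notin> g" if "g \<in> chains_in A k" for A and g :: "'a set set"
      using that by (auto simp: chains_in_def)
    then show "\<forall>z\<in>?T. (\<lambda>f. (\<Union>f, f - {\<Union>f})) (case z of (A, g) \<Rightarrow> insert A g) = z" by auto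
    have V: "\<Union>f \<in> f \<and> finite f" if "f \<in> ?F" for f
    proof -
      have "finite f" "f \<noteq> {}" using that by (auto intro: card_ge_0_finite)
      then show ?thesis using that by (auto intro!: Union_chain_in)
    qed
    then show "\<forall>f\<in>?F. (case (\<lambda>f. (\<Union>f, f - {\<Union>f})) f of (A, g) \<Rightarrow> insert A g) = f"
      by (auto simp: insert_absorb)
    show "(\<lambda>(A, g). insert A g) ` ?T \<subseteq> ?F"
    proof clarify
      fix A g assume A: "A \<in> S" and g: "g \<in> chains_in A k"
      have "finite g" using g S(2)[OF A] by (auto simp: chains_in_def intro: finite_subset[of _ "Pow A"])
      then have "card (insert A g) = Suc k" using g U[OF g] by (simp add: chains_in_def)
      moreover have "insert A g \<subseteq> S" using A g down[OF A] by (auto simp: chains_in_def)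
      ultimately show "insert A g \<subseteq> S \<and> (\<forall>B\<in>insert A g. \<forall>C\<in>insert A g. B \<subseteq> C \<or> C \<subseteq> B) \<and> card (insert A g) = Suc k"
        using g unfolding chains_in_def by blast
    qed
    show "(\<lambda>f. (\<Union>f, f - {\<Union>f})) ` ?F \<subseteq> ?T"
    proof (rule image_subsetI)
      fix f assume f: "f \<in> ?F"
      have "card (f - {\<Union>f}) = k" using V[OF f] f by simp
      moreover have "f - {\<Union>f} \<subseteq> Pow (\<Union>f) - {{}, \<Union>f}" using f S(3) by auto
      ultimately show "(\<Union>f, f - {\<Union>f}) \<in> ?T" using f V[OF f] by (auto simp: chains_in_def)
    qed
  qed
  then have "card ?F = card ?T" by (simp add: bij_betw_same_card)
  also have "\<dots> = (\<Sum>A\<in>S. card (chains_in A k))"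
    using S finite_chains_in by (intro card_SigmaI) auto
  finally show ?thesis .
qed

lemma card_chains_in: "finite X \<Longrightarrow> card (chains_in X k) = chain_count (card X) k"
proof (induction k arbitrary: X)
  case 0
  \<comment> \<open>Finiteness of \<open>X\<close> excludes infinite families, whose
    \<open>card\<close> is 0 too.\<close>
  have "chains_in X 0 = {{}}"
    using 0 by (auto simp: chains_in_def intro: finite_subset[of _ "Pow X"] dest!: card_eq_0_iff[THEN iffD1])
      (metis Diff_subset finite_Diff finite_Pow_iff rev_finite_subset)
  then show ?case by simp
next
  case (Suc k)
  let ?S = "Pow X - {{}, X}"
  have "card (chains_in X (Suc k)) = (\<Sum>A\<in>?S. card (chains_in A k))"
    unfolding chains_in_def[of X] using Suc.prems
    by (intro card_flags_Suc) (auto intro: finite_subset)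
  also have "\<dots> = (\<Sum>A\<in>?S. chain_count (card A) k)"
    using Suc by (intro sum.cong) (auto intro: finite_subset)
  also have "\<dots> = (\<Sum>j\<in>{1..<card X}. \<Sum>A\<in>{A \<in> ?S. card A = j}. chain_count (card A) k)"
  proof (rule sum.group[symmetric])
    show "card ` ?S \<subseteq> {1..<card X}"
    proof (rule image_subsetI)
      fix A assume "A \<in> ?S"
      then have "A \<subset> X" "A \<noteq> {}" "finite A" using finite_subset[OF _ Suc.prems] by auto
      then show "card A \<in> {1..<card X}"
        using psubset_card_mono[OF Suc.prems] by (auto simp: Suc_le_eq card_gt_0_iff)
    qed
  qed (use Suc.prems in auto)
  also have "\<dots> = (\<Sum>j\<in>{1..<card X}. (card X choose j) * chain_count j k)"
  proof (rule sum.cong)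
    fix j assume j: "j \<in> {1..<card X}"
    have "{A \<in> ?S. card A = j} = {A. A \<subseteq> X \<and> card A = j}" using j by auto
    then show "(\<Sum>A\<in>{A \<in> ?S. card A = j}. chain_count (card A) k) = (card X choose j) * chain_count j k"
      using n_subsets[OF Suc.prems, of j] by simp
  qed simp
  finally show ?case by simp
qed

section \<open>Index sequences as sizes of chain members\<close>

lemma finite_index_seqs: "finite (index_seqs k l)"
  by (rule finite_subset[OF _ finite_lists_length_eq[of "{1<..<l}" k]]) (auto simp: index_seqs_def)

lemma index_seqs_Suc:
  "index_seqs (Suc k) l = (\<lambda>(j, js). js @ [j]) ` (SIGMA j:{1<..<l}. index_seqs k j)"
proof (intro equalityI subsetI)
  fix js assume js: "js \<in> index_seqs (Suc k) l"
  then obtain ks j where e: "js = ks @ [j]" by (cases js rule: rev_cases) (auto simp: index_seqs_def)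
  then show "js \<in> (\<lambda>(j, js). js @ [j]) ` (SIGMA j:{1<..<l}. index_seqs k j)"
    using js by (intro image_eqI[of _ _ "(j, ks)"]) (auto simp: index_seqs_def sorted_wrt_append)
qed (fastforce simp: index_seqs_def sorted_wrt_append)

text \<open>The numbers \<open>js ! i - 1\<close> are the sizes of the members of a chain in a set
  with \<open>l - 1\<close> elements, and each binomial coefficient chooses a member inside the next
  one. Removing the last index gives the recursion of \<open>chain_count\<close>, shifted by
  one.\<close>

lemma sum_index_seqs:
  "1 \<le> l \<Longrightarrow> (\<Sum>js\<in>index_seqs k l. \<Prod>i<k. real (((js @ [l]) ! (i + 1) - 1) choose (js ! i - 1))) =
     real (chain_count (l - 1) k)"
proof (induction k arbitrary: l)
  case 0
  have "index_seqs 0 l = {[]}" by (auto simp: index_seqs_def)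
  then show ?case by simp
next
  case (Suc k)
  let ?g = "\<lambda>k l js. \<Prod>i<k. real (((js @ [l]) ! (i + 1) - 1) choose (js ! i - 1))"
  have inj: "inj_on (\<lambda>(j, js). js @ [j]) (SIGMA j:{1<..<l}. index_seqs k j)" by (auto simp: inj_on_def)
  have "(\<Sum>js\<in>index_seqs (Suc k) l. ?g (Suc k) l js) =
      (\<Sum>j\<in>{1<..<l}. \<Sum>js\<in>index_seqs k j. ?g (Suc k) l (js @ [j]))"
    unfolding index_seqs_Suc
    by (subst sum.reindex[OF inj]) (simp add: o_def sum.Sigma finite_index_seqs case_prod_unfold)
  also have "\<dots> = (\<Sum>j\<in>{1<..<l}. \<Sum>js\<in>index_seqs k j. real ((l - 1) choose (j - 1)) * ?g k j js)"
  proof (intro sum.cong refl)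
    fix j js assume js: "js \<in> index_seqs k j"
    then have len: "length js = k" by (simp add: index_seqs_def)
    have "(\<Prod>i<k. real (((js @ [j]) @ [l]) ! (i + 1) - 1 choose ((js @ [j]) ! i - 1))) = ?g k j js"
      using len by (intro prod.cong) (auto simp: nth_append)
    then show "?g (Suc k) l (js @ [j]) = real ((l - 1) choose (j - 1)) * ?g k j js"
      using len by (simp add: nth_append)
  qed
  also have "\<dots> = (\<Sum>j\<in>{1<..<l}. real ((l - 1) choose (j - 1)) * real (chain_count (j - 1) k))"
    using Suc.IH by (intro sum.cong refl) (simp del: One_nat_def add_Suc_right flip: sum_distrib_left)
  also have "\<dots> = (\<Sum>j\<in>{1..<l - 1}. real ((l - 1) choose j) * real (chain_count j k))"
    by (rule sum.reindex_bij_witness[of _ Suc "\<lambda>j. j - 1"]) auto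
  finally show ?case by simp
qed

section \<open>Compositions, partitions and multinomial coefficients\<close>

definition compositions :: "nat \<Rightarrow> nat \<Rightarrow> nat list set" where
  "compositions m l = {cs. length cs = l \<and> (\<forall>i\<in>set cs. 0 < i) \<and> sum_list cs = m}"

lemma finite_compositions: "finite (compositions m l)"
  by (rule finite_subset[OF _ finite_lists_length_eq[of "{..m}" l]])
    (auto simp: compositions_def member_le_sum_list)

lemma compositions_Suc:
  "compositions m (Suc (Suc k)) = (\<lambda>(j, cs). (m - j) # cs) ` (SIGMA j:{1..<m}. compositions j (Suc k))"
proof (intro equalityI subsetI)
  fix cs assume cs: "cs \<in> compositions m (Suc (Suc k))"
  then obtain c ds where e: "cs = c # ds" "length ds = Suc k" by (auto simp: compositions_def length_Suc_conv)
  moreover have "0 < sum_list ds"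
  proof -
    obtain d es where "ds = d # es" using e(2) by (auto simp: length_Suc_conv)
    then show ?thesis using cs e by (auto simp: compositions_def)
  qed
  ultimately show "cs \<in> (\<lambda>(j, cs). (m - j) # cs) ` (SIGMA j:{1..<m}. compositions j (Suc k))"
    using cs by (intro image_eqI[of _ _ "(sum_list ds, ds)"]) (auto simp: compositions_def)
qed (auto simp: compositions_def)

text \<open>A multinomial coefficient counts the ordered set partitions with prescribed block sizes,
  and \<open>k + 1\<close> blocks correspond to a chain with \<open>k\<close> members. The first
  part \<open>m - j\<close> is the size of the complement of the largest member, so the induction
  follows \<open>chain_count\<close>.\<close>

lemma sum_compositions:
  "1 \<le> m \<Longrightarrow> (\<Sum>cs\<in>compositions m (Suc k). fact m / (\<Prod>c\<leftarrow>cs. fact c)) = real (chain_count m k)"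
proof (induction k arbitrary: m)
  case 0
  then have "compositions m (Suc 0) = {[m]}" by (auto simp: compositions_def length_Suc_conv)
  then show ?case by simp
next
  case (Suc k)
  let ?g = "\<lambda>m cs. fact m / (\<Prod>c\<leftarrow>cs. fact c) :: real"
  have inj: "inj_on (\<lambda>(j, cs). (m - j) # cs) (SIGMA j:{1..<m}. compositions j (Suc k))"
    by (auto simp: inj_on_def)
  have "(\<Sum>cs\<in>compositions m (Suc (Suc k)). ?g m cs) =
      (\<Sum>j\<in>{1..<m}. \<Sum>cs\<in>compositions j (Suc k). ?g m ((m - j) # cs))"
    unfolding compositions_Suc
    by (subst sum.reindex[OF inj]) (simp add: o_def sum.Sigma finite_compositions case_prod_unfold)
  also have "\<dots> = (\<Sum>j\<in>{1..<m}. \<Sum>cs\<in>compositions j (Suc k). real (m choose j) * ?g j cs)"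
    by (intro sum.cong refl) (simp add: binomial_fact)
  also have "\<dots> = (\<Sum>j\<in>{1..<m}. real (m choose j) * real (chain_count j k))"
    using Suc.IH by (intro sum.cong refl) (simp del: times_divide_eq_right flip: sum_distrib_left)
  finally show ?case by simp
qed

text \<open>\<open>part_weight \<mu>\<close> is the number of distinct rearrangements of
  \<open>\<mu>\<close>. Sorting in decreasing order maps compositions to partitions, and the fibre
  over \<open>\<mu>\<close> consists of these rearrangements, on which \<open>g\<close> is
  constant.\<close>

lemma sum_partitions_weight:
  fixes g :: "nat list \<Rightarrow> real"
  assumes sym: "\<And>cs ds. mset cs = mset ds \<Longrightarrow> g cs = g ds"
  shows "(\<Sum>\<mu>\<in>{\<mu> \<in> partitions n. length \<mu> = l}. part_weight \<mu> * g \<mu>) = (\<Sum>cs\<in>compositions n l. g cs)"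
proof -
  let ?P = "{\<mu> \<in> partitions n. length \<mu> = l}"
  have sub: "?P \<subseteq> compositions n l" by (auto simp: partitions_def compositions_def)
  have finP: "finite ?P" using finite_subset[OF sub finite_compositions] .
  have perms: "{cs \<in> compositions n l. rev (sort cs) = \<mu>} = permutations_of_multiset (mset \<mu>)" if \<mu>: "\<mu> \<in> ?P" for \<mu>
  proof -
    have "rev (sort cs) = \<mu> \<longleftrightarrow> mset cs = mset \<mu>" for cs
    proof
      assume "mset cs = mset \<mu>"
      then have "sort cs = rev \<mu>"
        using \<mu> by (intro properties_for_sort) (auto simp: partitions_def sorted_wrt_rev)
      then show "rev (sort cs) = \<mu>" by simp
    qed (metis mset_rev mset_sort)
    moreover have "cs \<in> compositions n l" if "mset cs = mset \<mu>" for cs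
      using \<mu> that mset_eq_setD[OF that] mset_eq_length[OF that] sum_mset_sum_list[of cs] sum_mset_sum_list[of \<mu>]
      by (auto simp: partitions_def compositions_def)
    ultimately show ?thesis by (auto simp: permutations_of_multiset_def)
  qed
  have card_perms: "real (card (permutations_of_multiset (mset \<mu>))) = part_weight \<mu>" for \<mu> :: "nat list"
  proof -
    have "real (card (permutations_of_multiset (mset \<mu>))) =
        real (fact (length \<mu>) div (\<Prod>x\<in>set \<mu>. fact (count_list \<mu> x)))"
      by (simp add: card_permutations_of_multiset(1) count_mset)
    also have "\<dots> = fact (length \<mu>) / real (\<Prod>x\<in>set \<mu>. fact (count_list \<mu> x))"
      using card_permutations_of_multiset(2)[of "mset \<mu>"] by (subst real_of_nat_div) (auto simp: count_mset)
    finally show ?thesis by (simp add: part_weight_def)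
  qed
  have "(\<Sum>cs\<in>compositions n l. g cs) = (\<Sum>\<mu>\<in>?P. \<Sum>cs\<in>{cs \<in> compositions n l. rev (sort cs) = \<mu>}. g cs)"
  proof (rule sum.group[symmetric])
    show "(\<lambda>cs. rev (sort cs)) ` compositions n l \<subseteq> ?P"
    proof (rule image_subsetI)
      fix cs assume cs: "cs \<in> compositions n l"
      have "sum_list (sort cs) = sum_list cs" by (metis mset_sort sum_mset_sum_list)
      then show "rev (sort cs) \<in> ?P"
        using cs by (auto simp: partitions_def compositions_def sorted_wrt_rev sum_list_rev)
    qed
  qed (auto simp: finite_compositions finP)
  also have "\<dots> = (\<Sum>\<mu>\<in>?P. part_weight \<mu> * g \<mu>)"
  proof (intro sum.cong refl)
    fix \<mu> assume \<mu>: "\<mu> \<in> ?P"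
    have "(\<Sum>cs\<in>permutations_of_multiset (mset \<mu>). g cs) = (\<Sum>cs\<in>permutations_of_multiset (mset \<mu>). g \<mu>)"
      by (intro sum.cong sym) (auto simp: permutations_of_multiset_def)
    then show "(\<Sum>cs\<in>{cs \<in> compositions n l. rev (sort cs) = \<mu>}. g cs) = part_weight \<mu> * g \<mu>"
      unfolding perms[OF \<mu>] by (simp add: card_perms)
  qed
  finally show ?thesis by simp
qed

text \<open>A partition of length l stands for chains with m = l - 1 members. Weight times
  multinomial coefficient, summed over the partitions of this length, gives
  \<open>chain_count n m\<close>, and the inner sum is \<open>chain_count m k\<close>.\<close>

lemma partition_sum_eq:
  assumes n: "2 \<le> n"
  shows "(\<Sum>\<mu>\<in>{\<mu> \<in> partitions n. length \<mu> \<ge> 2 + k}.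
       part_weight \<mu> * (fact n / (\<Prod>i<length \<mu>. fact (\<mu> ! i))) *
       (\<Sum>js\<in>index_seqs k (length \<mu>).
          \<Prod>i<k. real (((js @ [length \<mu>]) ! (i + 1) - 1) choose (js ! i - 1)))) =
    (\<Sum>m\<in>{1..<n}. real (chain_count n m * chain_count m k))" (is "(\<Sum>\<mu>\<in>?A. ?h \<mu>) = _")
proof -
  let ?g = "\<lambda>cs. fact n / (\<Prod>c\<leftarrow>cs. fact c) * real (chain_count (length cs - 1) k)"
  have len: "length \<mu> \<le> n" if "\<mu> \<in> partitions n" for \<mu>
  proof -
    have "length xs \<le> sum_list xs" if "\<forall>i\<in>set xs. 0 < i" for xs :: "nat list"
      using that by (induction xs) auto
    then show ?thesis using that by (auto simp: partitions_def)
  qed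
  have "?A \<subseteq> (\<Union>l\<in>{2 + k..n}. compositions n l)" using len by (auto simp: partitions_def compositions_def)
  then have fin: "finite ?A" by (rule finite_subset) (auto simp: finite_compositions)
  have "(\<Sum>\<mu>\<in>?A. ?h \<mu>) = (\<Sum>\<mu>\<in>?A. part_weight \<mu> * ?g \<mu>)"
  proof (intro sum.cong refl)
    fix \<mu> assume "\<mu> \<in> ?A"
    then have "1 \<le> length \<mu>" by simp
    note s = sum_index_seqs[OF this, of k]
    show "?h \<mu> = part_weight \<mu> * ?g \<mu>"
      unfolding s by (simp add: prod.list_conv_set_nth atLeast0LessThan)
  qed
  also have "\<dots> = (\<Sum>l\<in>{2 + k..n}. \<Sum>\<mu>\<in>{\<mu> \<in> ?A. length \<mu> = l}. part_weight \<mu> * ?g \<mu>)"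
    using fin len by (intro sum.group[symmetric]) auto
  also have "\<dots> = (\<Sum>l\<in>{2 + k..n}. \<Sum>\<mu>\<in>{\<mu> \<in> partitions n. length \<mu> = l}. part_weight \<mu> * ?g \<mu>)"
    by (intro sum.cong) auto
  also have "\<dots> = (\<Sum>l\<in>{2 + k..n}. \<Sum>cs\<in>compositions n l. ?g cs)"
  proof (rule sum.cong[OF refl], rule sum_partitions_weight)
    fix cs ds :: "nat list" assume e: "mset cs = mset ds"
    then have "mset (map fact cs) = mset (map fact ds :: real list)" by simp
    then have "(\<Prod>c\<leftarrow>cs. fact c) = (\<Prod>c\<leftarrow>ds. fact c :: real)" by (metis prod_mset_prod_list)
    then show "?g cs = ?g ds" using mset_eq_length[OF e] by simp
  qed
  also have "\<dots> = (\<Sum>l\<in>{2 + k..n}. real (chain_count n (l - 1)) * real (chain_count (l - 1) k))"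
  proof (intro sum.cong refl)
    fix l assume "l \<in> {2 + k..n}"
    then have l: "Suc (l - 1) = l" by auto
    have "(\<Sum>cs\<in>compositions n l. ?g cs) =
        (\<Sum>cs\<in>compositions n (Suc (l - 1)). fact n / (\<Prod>c\<leftarrow>cs. fact c)) * real (chain_count (l - 1) k)"
      unfolding l sum_distrib_right by (intro sum.cong) (auto simp: compositions_def)
    then show "(\<Sum>cs\<in>compositions n l. ?g cs) = real (chain_count n (l - 1)) * real (chain_count (l - 1) k)"
      using n by (simp only: sum_compositions)
  qed
  also have "\<dots> = (\<Sum>m\<in>{1 + k..<n}. real (chain_count n m) * real (chain_count m k))"
    using n by (intro sum.reindex_bij_witness[of _ Suc "\<lambda>l. l - 1"]) auto
  \<comment> \<open>The added terms, with 1 \<le> m \<le> k, vanish: a chain in a set of m elements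
    has at most m - 1 members.\<close>
  also have "\<dots> = (\<Sum>m\<in>{1..<n}. real (chain_count n m) * real (chain_count m k))"
    by (rule sum.mono_neutral_left) (auto simp: chain_count_eq_0)
  finally show ?thesis by simp
qed

section \<open>Inequalities in a chamber\<close>

text \<open>For \<open>c \<notin> D\<close> between the neighbouring cut points \<open>u < c < v\<close> this set has \<open>(c - u) (v - c)\<close> elements,
  twice the coefficient at the \<open>c\<close>-th simple root of the half sum of the positive roots of the parabolic
  subsystem that omits the simple roots in \<open>D\<close>.\<close>

definition unsep :: "nat \<Rightarrow> nat set \<Rightarrow> nat \<Rightarrow> (nat \<times> nat) set" where
  "unsep n D c = {(i, j). i < c \<and> c \<le> j \<and> j < n \<and> (\<forall>d\<in>D. \<not> (i < d \<and> d \<le> j))}"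

lemma finite_unsep [simp]: "finite (unsep n D c)"
  by (rule finite_subset[of _ "{..<c} \<times> {..<n}"]) (auto simp: unsep_def)

lemma unsep_antimono: "D \<subseteq> D' \<Longrightarrow> unsep n D' c \<subseteq> unsep n D c"
  by (auto simp: unsep_def)

lemma unsep_mem: "c \<in> D \<Longrightarrow> unsep n D c = {}"
  by (auto simp: unsep_def)

lemma neighbours_in_unsep: "c \<notin> D \<Longrightarrow> 1 \<le> c \<Longrightarrow> c < n \<Longrightarrow> (c - 1, c) \<in> unsep n D c"
proof -
  assume c: "c \<notin> D" "1 \<le> c" "c < n"
  have "\<not> (c - 1 < d \<and> d \<le> c)" if "d \<in> D" for d
  proof
    assume "c - 1 < d \<and> d \<le> c"
    then have "d = c" using c(2) by linarith
    then show False using c(1) that by simp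
  qed
  then show ?thesis using c by (auto simp: unsep_def)
qed

lemma card_unsep_pos: "c \<notin> D \<Longrightarrow> c \<in> {1..<n} \<Longrightarrow> 1 \<le> card (unsep n D c)"
  using neighbours_in_unsep[of c D n] by (auto simp: Suc_le_eq card_gt_0_iff)

text \<open>\<open>I\<close> and \<open>J\<close> are the blocks of indices just left and right of
  the cut \<open>c\<close>, and an unseparated pair takes one index from each. Every cut point in
  \<open>D\<close> uses up a further index outside both blocks, namely \<open>h d\<close>: the one
  before the cut if it lies at or left of \<open>c\<close>, the one after it otherwise. So the block
  lengths add up to at most \<open>n - card D\<close>, and the inequality of arithmetic and
  geometric means bounds their product.\<close>

lemma card_unsep_le:
  assumes D: "D \<subseteq> {1..<n}"
  shows "card (unsep n D c) \<le> (n - card D)\<^sup>2 div 4"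
proof (cases "c < n")
  case True
  define I where "I = {i. i < c \<and> (\<forall>d\<in>D. \<not> (i < d \<and> d \<le> c))}"
  define J where "J = {j. c \<le> j \<and> j < n \<and> (\<forall>d\<in>D. \<not> (c \<le> d \<and> d \<le> j))}"
  define h where "h = (\<lambda>d. if d \<le> c then d - 1 else d :: nat)"
  have fin: "finite D" "finite I" "finite J"
    using D by (auto intro: finite_subset simp: I_def J_def)
  have sub: "unsep n D c \<subseteq> I \<times> J"
    by (fastforce simp: unsep_def I_def J_def)
  have injh: "inj_on h D"
  proof (rule inj_onI)
    fix d d' assume dd: "d \<in> D" "d' \<in> D" and e: "h d = h d'"
    have "1 \<le> d" "1 \<le> d'" using dd D by auto
    then show "d = d'" using e by (auto simp: h_def split: if_splits)
  qed
  have disj: "I \<inter> J = {}" "h ` D \<inter> (I \<union> J) = {}"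
    using D True by (auto simp: I_def J_def h_def split: if_splits)
  have "card (I \<union> J \<union> h ` D) \<le> card {..<n}"
    using D True by (intro card_mono) (fastforce simp: I_def J_def h_def)+
  moreover have "card (I \<union> J \<union> h ` D) = card I + card J + card D"
    using disj fin injh by (subst card_Un_disjoint) (auto simp: card_Un_disjoint card_image)
  ultimately have le: "card I + card J \<le> n - card D" by simp
  have "4 * (card I * card J) \<le> (card I + card J)\<^sup>2"
  proof -
    have "0 \<le> (int (card I) - int (card J))\<^sup>2" by simp
    then have "4 * (int (card I) * int (card J)) \<le> (int (card I) + int (card J))\<^sup>2"
      by (simp add: power2_eq_square algebra_simps)
    then show ?thesis by (metis of_nat_add of_nat_le_iff of_nat_mult of_nat_numeral of_nat_power)
  qed
  also have "\<dots> \<le> (n - card D)\<^sup>2" using le by (rule power_mono) simp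
  finally have "card I * card J \<le> (n - card D)\<^sup>2 div 4" by simp
  moreover have "card (unsep n D c) \<le> card I * card J"
    using card_mono[OF _ sub] fin by (simp add: card_cartesian_product)
  ultimately show ?thesis by simp
next
  case False
  then have "unsep n D c = {}" by (auto simp: unsep_def)
  then show ?thesis by simp
qed

text \<open>The set \<open>unsep n A c\<close> determines the cut points of \<open>A\<close> nearest
  to \<open>c\<close> on either side. If both \<open>C\<close> and \<open>D\<close> agree with their
  union there, then the nearest cut points of the union belong to both sets, hence to the
  intersection.\<close>

lemma unsep_Int_eq:
  assumes c: "c \<in> {1..<n}"
    and eqC: "unsep n C c = unsep n (C \<union> D) c" and eqD: "unsep n D c = unsep n (C \<union> D) c"
  shows "unsep n (C \<inter> D) c = unsep n (C \<union> D) c"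
proof
  show "unsep n (C \<union> D) c \<subseteq> unsep n (C \<inter> D) c" by (rule unsep_antimono) auto
  have same: "d \<in> C \<longleftrightarrow> d \<in> D" if "d \<in> C \<union> D" "i < d" "d \<le> j" "i < c" "c \<le> j" "j < n"
    "(i, j) \<in> unsep n (C \<inter> D) c" for i j d
  proof (cases "c \<in> C \<union> D")
    case True
    then have "unsep n (C \<union> D) c = {}" by (rule unsep_mem)
    then have "c \<in> C" "c \<in> D"
      using eqC eqD neighbours_in_unsep[of c C n] neighbours_in_unsep[of c D n] c by auto
    then show ?thesis using that by (auto simp: unsep_def)
  next
    case cn: False
    \<comment> \<open>If \<open>A\<close> missed a cut point \<open>d\<close> nearest to
      \<open>c\<close>, then the pair \<open>(d - 1, c)\<close> or \<open>(c - 1, d)\<close>, which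
      no other cut point of the union separates, would be unseparated by \<open>A\<close> but not by
      the union.\<close>
    have main: "d \<in> A" if A: "unsep n A c = unsep n (C \<union> D) c" "d \<in> C \<union> D"
      "\<And>d'. d' \<in> C \<union> D \<Longrightarrow> (d < c \<and> d < d' \<and> d' < c) \<or> (c < d \<and> c < d' \<and> d' < d) \<Longrightarrow> False"
      "i < d" "d \<le> j" "A \<subseteq> C \<union> D"
      for A d
    proof (rule ccontr)
      assume dA: "d \<notin> A"
      have "d \<noteq> c" using cn A(2) by auto
      show False
      proof (cases "d < c")
        case True
        have "(d - 1, c) \<in> unsep n A c"
          using True c A(3,4,6) dA cn by (auto simp: unsep_def) (metis UnE Suc_pred \<open>d < c\<close> le_neq_implies_less less_Suc_eq_le linorder_neqE_nat not_less_iff_gr_or_eq subsetD gr_zeroI less_zeroE)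
        moreover have "(d - 1, c) \<notin> unsep n (C \<union> D) c" using A(2,4) True by (auto simp: unsep_def)
        ultimately show False using A(1) by auto
      next
        case False
        then have "c < d" using \<open>d \<noteq> c\<close> by simp
        have nn: "\<not> (c - 1 < e \<and> e \<le> d)" if "e \<in> A" for e
        proof
          assume "c - 1 < e \<and> e \<le> d"
          moreover have "e \<noteq> c" "e \<noteq> d" "e \<in> C \<union> D" using that cn dA A(6) by auto
          ultimately have "c < e" "e < d" "e \<in> C \<union> D" by linarith+
          then show False using A(3)[of e] \<open>c < d\<close> by blast
        qed
        have "(c - 1, d) \<in> unsep n A c"
          using \<open>c < d\<close> c A(5) \<open>j < n\<close> nn by (auto simp: unsep_def)
        moreover have "c - 1 < d" using \<open>c < d\<close> by simp
        then have "(c - 1, d) \<notin> unsep n (C \<union> D) c" using A(2) by (auto simp: unsep_def)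
        ultimately show False using A(1) by auto
      qed
    qed
    have False
    proof (cases "d < c")
      case True
      \<comment> \<open>The argument of \<open>main\<close> needs a cut point adjacent to
        \<open>c\<close>, so \<open>d\<close> is replaced by the cut point nearest to
        \<open>c\<close> that still separates \<open>i\<close> from \<open>j\<close>. The other side
        is symmetric.\<close>
      define S where "S = {e \<in> C \<union> D. i < e \<and> e < c}"
      have S: "finite S" "d \<in> S" using that True by (auto simp: S_def intro: finite_subset[of _ "{..<c}"])
      obtain q where q: "q \<in> S" "\<And>e. e \<in> S \<Longrightarrow> e \<le> q"
        using S Max_in[of S] Max_ge[of S] by blast
      have gap: False if "e \<in> C \<union> D" "(q < c \<and> q < e \<and> e < c) \<or> (c < q \<and> c < e \<and> e < q)" for e
        using q(1) q(2)[of e] that by (auto simp: S_def)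
      have "q \<in> C \<union> D" "i < q" "q \<le> j" using q(1) that(5) by (auto simp: S_def)
      note q' = this
      have "q \<in> C" by (rule main[OF eqC]) (use q' gap in auto)
      moreover have "q \<in> D" by (rule main[OF eqD]) (use q' gap in auto)
      ultimately show False using \<open>i < q\<close> \<open>q \<le> j\<close> that(7) by (auto simp: unsep_def)
    next
      case False
      then have "c < d" using cn that(1) by (metis linorder_neqE_nat)
      define S where "S = {e \<in> C \<union> D. c < e \<and> e \<le> j}"
      have S: "finite S" "d \<in> S" using that \<open>c < d\<close> by (auto simp: S_def intro: finite_subset[of _ "{..j}"])
      obtain q where q: "q \<in> S" "\<And>e. e \<in> S \<Longrightarrow> q \<le> e"
        using S Min_in[of S] Min_le[of S] by blast
      have gap: False if "e \<in> C \<union> D" "(q < c \<and> q < e \<and> e < c) \<or> (c < q \<and> c < e \<and> e < q)" for e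
        using q(1) q(2)[of e] that by (auto simp: S_def)
      have "q \<in> C \<union> D" "i < q" "q \<le> j" using q(1) that(4) by (auto simp: S_def)
      note q' = this
      have "q \<in> C" by (rule main[OF eqC]) (use q' gap in auto)
      moreover have "q \<in> D" by (rule main[OF eqD]) (use q' gap in auto)
      ultimately show False using \<open>i < q\<close> \<open>q \<le> j\<close> that(7) by (auto simp: unsep_def)
    qed
    then show ?thesis ..
  qed
  show "unsep n (C \<inter> D) c \<subseteq> unsep n (C \<union> D) c"
  proof
    fix z assume z: "z \<in> unsep n (C \<inter> D) c"
    obtain i j where zij: "z = (i, j)" by force
    have "\<not> (i < d \<and> d \<le> j)" if "d \<in> C \<union> D" for d
      using same[of d i j] that z by (auto simp: unsep_def zij)
    then show "z \<in> unsep n (C \<union> D) c" using z by (auto simp: unsep_def zij)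
  qed
qed

text \<open>If \<open>\<kappa> c\<close> is the difference of the coordinates before and after the
  cut \<open>c\<close>, this is the sum of x_i - x_j over the pairs i < j that \<open>D\<close> does
  not separate, that is, twice the inner product of x with the half sum of positive roots of the
  parabolic subsystem belonging to \<open>D\<close>.\<close>

definition gap_sum :: "nat \<Rightarrow> nat set \<Rightarrow> (nat \<Rightarrow> real) \<Rightarrow> real" where
  "gap_sum n D \<kappa> = (\<Sum>c\<in>{1..<n}. \<kappa> c * real (card (unsep n D c)))"

lemma gap_sum_full [simp]: "gap_sum n {Suc 0..<n} \<kappa> = 0"
  unfolding gap_sum_def by (rule sum.neutral) (auto simp: unsep_mem)

lemma gap_sum_add: "gap_sum n D (\<lambda>c. \<kappa> c + t * y c) = gap_sum n D \<kappa> + t * gap_sum n D y"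
  by (simp add: gap_sum_def algebra_simps sum.distrib sum_distrib_left)

lemma gap_sum_upd:
  assumes "c \<in> {1..<n}"
  shows "gap_sum n D (\<kappa>(c := v)) = gap_sum n D \<kappa> + (v - \<kappa> c) * real (card (unsep n D c))"
proof -
  have "gap_sum n D (\<kappa>(c := v)) = v * real (card (unsep n D c)) + (\<Sum>d\<in>{1..<n} - {c}. \<kappa> d * real (card (unsep n D d)))"
    unfolding gap_sum_def using assms by (subst sum.remove[of _ c]) auto
  moreover have "gap_sum n D \<kappa> = \<kappa> c * real (card (unsep n D c)) + (\<Sum>d\<in>{1..<n} - {c}. \<kappa> d * real (card (unsep n D d)))"
    unfolding gap_sum_def using assms by (subst sum.remove[of _ c]) auto
  ultimately show ?thesis by (simp add: algebra_simps)
qed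

text \<open>The system is triangular. Gaps at cut points drop out, so equation \<open>m\<close>
  involves only the gaps at \<open>p m\<close> and later values of \<open>p\<close>, and the
  coefficient at \<open>p m\<close> is at least 1. Solving backwards, a change of the gap at
  \<open>p m\<close> corrects equation \<open>m\<close> without disturbing later equations, in which
  \<open>p m\<close> is a cut point.\<close>

lemma gap_sum_solve:
  assumes p: "bij_betw p {..<n - 1} {1..<n}"
  shows "\<exists>\<kappa>. \<forall>m<n - 1. gap_sum n (p ` {..<m}) \<kappa> = r m"
proof -
  have "\<exists>\<kappa>. \<forall>m. n - 1 - t \<le> m \<and> m < n - 1 \<longrightarrow> gap_sum n (p ` {..<m}) \<kappa> = r m" if "t \<le> n - 1" for t
    using that
  proof (induction t)
    case (Suc t)
    then obtain \<kappa> where \<kappa>: "\<And>m. n - 1 - t \<le> m \<Longrightarrow> m < n - 1 \<Longrightarrow> gap_sum n (p ` {..<m}) \<kappa> = r m"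
      by fastforce
    define m where "m = n - 1 - Suc t"
    have m: "m < n - 1" using Suc.prems by (simp add: m_def)
    have pm: "p m \<in> {1..<n}" using p m by (auto simp: bij_betw_def)
    have notin: "p m \<notin> p ` {..<m}"
      using inj_on_image_mem_iff[OF bij_betw_imp_inj_on[OF p], of m "{..<m}"] m by auto
    let ?w = "real (card (unsep n (p ` {..<m}) (p m)))"
    have w: "?w \<ge> 1" using card_unsep_pos[OF notin pm] by simp
    let ?k = "\<kappa>(p m := \<kappa> (p m) + (r m - gap_sum n (p ` {..<m}) \<kappa>) / ?w)"
    have "gap_sum n (p ` {..<m'}) ?k = r m'" if "n - 1 - Suc t \<le> m'" "m' < n - 1" for m'
    proof (cases "m' = m")
      case True
      have "?w \<noteq> 0" using w by linarith
      then show ?thesis using True by (simp add: gap_sum_upd[OF pm])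
    next
      case False
      then have "m < m'" using that m_def by simp
      then have "unsep n (p ` {..<m'}) (p m) = {}" by (intro unsep_mem) auto
      then show ?thesis using \<kappa>[of m'] that \<open>m < m'\<close> gap_sum_upd[OF pm] by (simp add: m_def)
    qed
    then show ?case by blast
  qed auto
  from this[of "n - 1"] show ?thesis by auto
qed

text \<open>Here \<open>\<eta>\<close> is the suitable list, extended by \<open>\<eta> 0 = 0\<close>, and \<open>(i + 1)\<^sup>2 div 4\<close> is $R^i_{i-1}$.\<close>

locale growth =
  fixes n :: nat and \<eta> :: "nat \<Rightarrow> real"
  assumes eta_0: "\<eta> 0 = 0"
    and growth: "\<And>i. 1 \<le> i \<Longrightarrow> i < n \<Longrightarrow> 2 * real ((i + 1)\<^sup>2 div 4) * \<eta> (i - 1) < \<eta> i"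
begin

section \<open>Consequences of the growth condition\<close>

lemma K_ge_1: "1 \<le> i \<Longrightarrow> 1 \<le> real ((i + 1)\<^sup>2 div 4)" for i :: nat
proof -
  assume "1 \<le> i"
  then have "2\<^sup>2 \<le> (i + 1)\<^sup>2" by (intro power_mono) auto
  then have "1 \<le> (i + 1)\<^sup>2 div 4" by simp
  then show ?thesis by linarith
qed

lemma eta_nonneg: "i < n \<Longrightarrow> 0 \<le> \<eta> i"
proof (induction i)
  case (Suc i)
  then show ?case using growth[of "Suc i"] by (simp add: mult_nonneg_nonneg) (smt (verit) mult_nonneg_nonneg of_nat_0_le_iff)
qed (simp add: eta_0)

lemma eta_Suc_less: "Suc i < n \<Longrightarrow> \<eta> i < \<eta> (Suc i)"
proof -
  assume i: "Suc i < n"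
  have "1 * \<eta> i \<le> 2 * real ((Suc i + 1)\<^sup>2 div 4) * \<eta> i"
    using K_ge_1[of "Suc i"] eta_nonneg[of i] i by (intro mult_right_mono) auto
  then show ?thesis using growth[of "Suc i"] i by simp
qed

lemma eta_mono: "i \<le> j \<Longrightarrow> j < n \<Longrightarrow> \<eta> i \<le> \<eta> j"
  by (induction j) (auto simp: le_Suc_eq dest: eta_Suc_less)

text \<open>These are the chain inequalities for initial segments of a sorted enumeration, written
  in consecutive differences and doubled because \<open>gap_sum\<close> carries no factor 1/2. The
  empty cut set contributes 0 \<le> 0.\<close>

definition feasible :: "(nat \<Rightarrow> real) \<Rightarrow> bool" where
  "feasible \<kappa> \<longleftrightarrow> (\<forall>c\<in>{1..<n}. 0 \<le> \<kappa> c) \<and>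
     (\<forall>D\<subseteq>{1..<n}. gap_sum n {} \<kappa> - gap_sum n D \<kappa> \<le> 2 * (\<eta> (n - 1) - \<eta> (n - 1 - card D)))"

definition tight :: "(nat \<Rightarrow> real) \<Rightarrow> nat set \<Rightarrow> bool" where
  "tight \<kappa> D \<longleftrightarrow> gap_sum n {} \<kappa> - gap_sum n D \<kappa> = 2 * (\<eta> (n - 1) - \<eta> (n - 1 - card D))"

lemma card_cuts: "D \<subseteq> {1..<n} \<Longrightarrow> card D \<le> n - 1"
  using card_mono[of "{1..<n}" D] by simp

text \<open>If the gap at \<open>c0 \<in> C\<close> vanished, removing \<open>c0\<close> from \<open>C\<close> would scale \<open>gap_sum\<close> by at most \<open>K\<close>.\<close>

lemma tight_imp_pos:
  assumes feas: "feasible \<kappa>" and C: "C \<subseteq> {1..<n}" and t: "tight \<kappa> C" and c0: "c0 \<in> C"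
  shows "0 < \<kappa> c0"
proof (rule ccontr)
  assume "\<not> 0 < \<kappa> c0"
  then have k0: "\<kappa> c0 = 0" using feas c0 C by (force simp: feasible_def)
  define E where "E = C - {c0}"
  define i where "i = n - card C"
  define K where "K = real ((i + 1)\<^sup>2 div 4)"
  have finC: "finite C" using C finite_subset by blast
  have cC: "1 \<le> card C" "card C \<le> n - 1" using c0 finC card_cuts[OF C] by (auto simp: Suc_le_eq card_gt_0_iff)
  have cE: "card E = card C - 1" using c0 finC by (simp add: E_def)
  have i: "1 \<le> i" "i < n" "n - 1 - card C = i - 1" "n - 1 - card E = i" "n - card E = i + 1"
    using cC cE by (auto simp: i_def)
  have E: "E \<subseteq> {1..<n}" using C by (auto simp: E_def)
  have "gap_sum n E \<kappa> \<le> K * gap_sum n C \<kappa>"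
    unfolding gap_sum_def sum_distrib_left
  proof (rule sum_mono)
    fix c assume c: "c \<in> {1..<n}"
    have kc: "0 \<le> \<kappa> c" using feas c by (auto simp: feasible_def)
    show "\<kappa> c * real (card (unsep n E c)) \<le> K * (\<kappa> c * real (card (unsep n C c)))"
    proof (cases "c \<in> C")
      case True
      then show ?thesis using k0 by (cases "c = c0") (auto simp: E_def unsep_mem)
    next
      case False
      have "real (card (unsep n E c)) \<le> K"
        using card_unsep_le[OF E, of c] i unfolding K_def by simp
      also have "\<dots> \<le> K * real (card (unsep n C c))"
        using card_unsep_pos[OF False c] K_ge_1[OF i(1)] by (simp add: K_def mult_left_le)
      finally have "\<kappa> c * real (card (unsep n E c)) \<le> \<kappa> c * (K * real (card (unsep n C c)))"
        using kc by (rule mult_left_mono)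
      then show ?thesis by (simp add: algebra_simps)
    qed
  qed
  moreover have "gap_sum n {} \<kappa> \<le> 2 * \<eta> (n - 1)"
    using feas unfolding feasible_def by (auto dest!: spec[of _ "{1..<n}"] simp: eta_0)
  moreover have "gap_sum n {} \<kappa> - gap_sum n E \<kappa> \<le> 2 * (\<eta> (n - 1) - \<eta> i)"
    using feas E i unfolding feasible_def by metis
  moreover have "gap_sum n C \<kappa> = gap_sum n {} \<kappa> - 2 * (\<eta> (n - 1) - \<eta> (i - 1))"
    using t i by (simp add: tight_def)
  \<comment> \<open>Let s = 2 \<eta> (n - 1) - gap_sum n {} \<kappa>, the slack of the inequality
    with all cut points. The facts so far combine to 2 \<eta> i - s \<le> K (2 \<eta> (i - 1) - s),
    and K \<ge> 1 allows s to be dropped.\<close>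
  moreover have "0 \<le> (K - 1) * (2 * \<eta> (n - 1) - gap_sum n {} \<kappa>)"
    using K_ge_1[OF i(1)] calculation(2) by (simp add: K_def)
  ultimately have "2 * \<eta> i \<le> 2 * K * \<eta> (i - 1)" by (simp add: algebra_simps)
  moreover have "2 * K * \<eta> (i - 1) < \<eta> i" using growth[OF i(1,2)] by (simp add: K_def)
  ultimately show False using eta_nonneg[OF i(2)] by simp
qed

text \<open>If \<open>C\<close> and \<open>D\<close> are incomparable, both have more cut points
  than their intersection \<open>E\<close>. Up to a common slack, feasibility at \<open>E\<close>
  keeps its gap sum above 2 \<eta> i, while tightness keeps those of \<open>C\<close> and
  \<open>D\<close> below 2 \<eta> (i - 1) each. The submodularity estimate turns this into 2 \<eta>
  i \<le> 4 K \<eta> (i - 1), which the factor 2 in suitable lists excludes.\<close>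

lemma tight_imp_comparable:
  assumes feas: "feasible \<kappa>" and C: "C \<subseteq> {1..<n}" and D: "D \<subseteq> {1..<n}"
    and tC: "tight \<kappa> C" and tD: "tight \<kappa> D"
  shows "C \<subseteq> D \<or> D \<subseteq> C"
proof (rule ccontr)
  assume inc: "\<not> (C \<subseteq> D \<or> D \<subseteq> C)"
  define E where "E = C \<inter> D"
  define F where "F = C \<union> D"
  define i where "i = n - 1 - card E"
  define K where "K = real ((i + 1)\<^sup>2 div 4)"
  have EF: "E \<subseteq> {1..<n}" "F \<subseteq> {1..<n}" using C D by (auto simp: E_def F_def)
  have fin: "finite C" "finite D" using C D finite_subset by blast+
  have "card E < card C" "card E < card D"
    using inc fin by (auto simp: E_def intro!: psubset_card_mono)
  moreover have "card C \<le> n - 1" "card D \<le> n - 1" using card_cuts C D by auto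
  ultimately have i: "1 \<le> i" "i < n" "n - 1 - card C \<le> i - 1" "n - 1 - card D \<le> i - 1" "n - card E = i + 1"
    by (auto simp: i_def)
  have K1: "1 \<le> K" using K_ge_1[OF i(1)] by (simp add: K_def)
  txt \<open>Termwise: the bracket on the right has nonnegative integer coefficients, and where one of them
    is 0 the coefficient on the left is 0 too.\<close>
  have "gap_sum n E \<kappa> - gap_sum n F \<kappa> \<le> K * (gap_sum n C \<kappa> + gap_sum n D \<kappa> - 2 * gap_sum n F \<kappa>)"
  proof -
    have "\<kappa> c * (real (card (unsep n E c)) - real (card (unsep n F c))) \<le>
        \<kappa> c * (K * (real (card (unsep n C c)) + real (card (unsep n D c)) - 2 * real (card (unsep n F c))))"
      if c: "c \<in> {1..<n}" for c
    proof (rule mult_left_mono)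
      show "0 \<le> \<kappa> c" using feas c by (auto simp: feasible_def)
      have le: "card (unsep n F c) \<le> card (unsep n C c)" "card (unsep n F c) \<le> card (unsep n D c)"
        by (intro card_mono unsep_antimono; simp add: F_def)+
      show "real (card (unsep n E c)) - real (card (unsep n F c)) \<le>
        K * (real (card (unsep n C c)) + real (card (unsep n D c)) - 2 * real (card (unsep n F c)))"
      proof (cases "card (unsep n F c) = card (unsep n C c) \<and> card (unsep n F c) = card (unsep n D c)")
        case True
        have "unsep n F c \<subseteq> unsep n C c" "unsep n F c \<subseteq> unsep n D c"
          by (intro unsep_antimono; simp add: F_def)+
        then have "unsep n C c = unsep n F c" "unsep n D c = unsep n F c"
          using True by (metis card_subset_eq finite_unsep)+
        then have "unsep n E c = unsep n F c"
          using unsep_Int_eq[OF c] by (simp add: E_def F_def)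
        moreover have "card (unsep n C c) = card (unsep n F c)" "card (unsep n D c) = card (unsep n F c)"
          using True by auto
        ultimately show ?thesis by simp
      next
        case False
        have "real (card (unsep n E c)) \<le> K"
          using card_unsep_le[OF EF(1), of c] i(5) unfolding K_def by simp
        also have "\<dots> \<le> K * (real (card (unsep n C c)) + real (card (unsep n D c)) - 2 * real (card (unsep n F c)))"
          using le False K1 by (intro mult_le_cancel_left1[THEN iffD2]) linarith
        finally show ?thesis by linarith
      qed
    qed
    then have "(\<Sum>c\<in>{1..<n}. \<kappa> c * (real (card (unsep n E c)) - real (card (unsep n F c)))) \<le>
       (\<Sum>c\<in>{1..<n}. \<kappa> c * (K * (real (card (unsep n C c)) + real (card (unsep n D c)) - 2 * real (card (unsep n F c)))))"
      by (intro sum_mono) auto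
    then show ?thesis
      by (simp add: gap_sum_def algebra_simps sum.distrib sum_subtractf sum_distrib_left)
  qed
  moreover have "gap_sum n {} \<kappa> - gap_sum n E \<kappa> \<le> 2 * (\<eta> (n - 1) - \<eta> i)"
    using feas EF unfolding feasible_def i_def by metis
  moreover have "gap_sum n {} \<kappa> - gap_sum n F \<kappa> \<le> 2 * \<eta> (n - 1)"
    using feas EF eta_nonneg[of "n - 1 - card F"] i(2) unfolding feasible_def
    by (smt (verit) diff_less_Suc le_less_trans diff_le_self less_imp_diff_less Suc_pred' gr0I not_less_zero)
  moreover have "gap_sum n C \<kappa> \<le> gap_sum n {} \<kappa> - 2 * (\<eta> (n - 1) - \<eta> (i - 1))"
    using tC eta_mono[OF i(3)] i(2) by (force simp: tight_def)
  moreover have "gap_sum n D \<kappa> \<le> gap_sum n {} \<kappa> - 2 * (\<eta> (n - 1) - \<eta> (i - 1))"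
    using tD eta_mono[OF i(4)] i(2) by (force simp: tight_def)
  ultimately have *: "gap_sum n E \<kappa> - gap_sum n F \<kappa> \<le> K * (gap_sum n C \<kappa> + gap_sum n D \<kappa> - 2 * gap_sum n F \<kappa>)"
    "gap_sum n {} \<kappa> - gap_sum n E \<kappa> \<le> 2 * (\<eta> (n - 1) - \<eta> i)"
    "0 \<le> gap_sum n F \<kappa> - gap_sum n {} \<kappa> + 2 * \<eta> (n - 1)"
    "gap_sum n C \<kappa> + gap_sum n D \<kappa> \<le> 2 * gap_sum n {} \<kappa> - 4 * (\<eta> (n - 1) - \<eta> (i - 1))"
    by auto
  \<comment> \<open>In terms of \<open>q\<close> the left side of the estimate is at least 2 \<eta>
    i - q and the bracket on the right at most 4 \<eta> (i - 1) - 2 q. The coefficient -(2 K - 1)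
    that remains for \<open>q\<close> has the favourable sign.\<close>
  define q where "q = gap_sum n F \<kappa> - gap_sum n {} \<kappa> + 2 * \<eta> (n - 1)"
  have "2 * \<eta> i - q \<le> gap_sum n E \<kappa> - gap_sum n F \<kappa>" using *(2) by (simp add: q_def)
  also have "\<dots> \<le> K * (4 * \<eta> (i - 1) - 2 * q)"
    using *(1) by (rule order_trans) (use *(4) K1 in \<open>auto simp: q_def intro!: mult_left_mono\<close>)
  finally have "2 * \<eta> i \<le> 4 * K * \<eta> (i - 1) - (2 * K - 1) * q" by (simp add: algebra_simps)
  moreover have "0 \<le> (2 * K - 1) * q" using K1 *(3) by (simp add: q_def)
  moreover have "2 * K * \<eta> (i - 1) < \<eta> i" using growth[OF i(1,2)] by (simp add: K_def)
  ultimately show False by simp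
qed

text \<open>Downward induction on \<open>m\<close>: the equation for \<open>p ` {..<m}\<close> exceeds the one for \<open>p ` {..<Suc m}\<close> by so much
  that the gap at \<open>p m\<close> has to account for it.\<close>

lemma vertex_pos:
  assumes p: "bij_betw p {..<n - 1} {1..<n}"
    and \<kappa>: "\<And>m. m \<le> n - 1 \<Longrightarrow> gap_sum n (p ` {..<m}) \<kappa> = 2 * \<eta> (n - 1 - m)"
    and m: "m < n - 1"
  shows "2 * \<eta> (n - 2 - m) < \<kappa> (p m)"
  using m
proof (induction "n - 1 - m" arbitrary: m rule: less_induct)
  case less
  define i where "i = n - 1 - m"
  define K where "K = real ((i + 1)\<^sup>2 div 4)"
  define w where "w = (\<lambda>m t. real (card (unsep n (p ` {..<m}) (p t))))"
  have i: "1 \<le> i" "i < n" "n - 2 - m = i - 1" using less.prems by (auto simp: i_def)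
  have K1: "1 \<le> K" using K_ge_1[OF i(1)] by (simp add: K_def)
  have inj: "inj_on p {..<n - 1}" using p by (simp add: bij_betw_def)
  have range: "p t \<in> {1..<n}" if "t < n - 1" for t using p that by (auto simp: bij_betw_def)
  have later: "0 \<le> \<kappa> (p t)" if t: "t \<in> {Suc m..<n - 1}" for t
  proof -
    have "2 * \<eta> (n - 2 - t) < \<kappa> (p t)" using less.hyps[of t] t by auto
    moreover have "0 \<le> \<eta> (n - 2 - t)" using t by (intro eta_nonneg) auto
    ultimately show ?thesis by simp
  qed
  have expand: "gap_sum n (p ` {..<m}) \<kappa> = (\<Sum>t\<in>{m..<n - 1}. \<kappa> (p t) * w m t)" if "m \<le> n - 1" for m
  proof -
    have "gap_sum n (p ` {..<m}) \<kappa> = (\<Sum>t\<in>{..<n - 1}. \<kappa> (p t) * w m t)"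
      unfolding gap_sum_def w_def by (rule sum.reindex_bij_betw[OF p, symmetric])
    also have "\<dots> = (\<Sum>t\<in>{m..<n - 1}. \<kappa> (p t) * w m t)"
      by (rule sum.mono_neutral_right) (auto simp: w_def unsep_mem)
    finally show ?thesis .
  qed
  have "card (p ` {..<m}) = m"
    using card_image[OF inj_on_subset[OF inj, of "{..<m}"]] less.prems by auto
  moreover have "p ` {..<m} \<subseteq> {1..<n}" using range less.prems by auto
  ultimately have wK: "w m t \<le> K" for t
    using card_unsep_le[of "p ` {..<m}" n "p t"] less.prems by (simp add: w_def K_def i_def Suc_diff_Suc flip: Suc_diff_le)
  \<comment> \<open>In equation \<open>Suc m\<close> all remaining coefficients are at least 1, and
    the later gaps are nonnegative by induction, so its right-hand side bounds their plain
    sum.\<close>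
  have "(\<Sum>t\<in>{Suc m..<n - 1}. \<kappa> (p t)) \<le> (\<Sum>t\<in>{Suc m..<n - 1}. \<kappa> (p t) * w (Suc m) t)"
  proof (rule sum_mono)
    fix t assume t: "t \<in> {Suc m..<n - 1}"
    then have "p t \<notin> p ` {..<Suc m}"
      using inj_on_image_mem_iff[OF inj, of t "{..<Suc m}"] by auto
    then have "1 \<le> w (Suc m) t"
      using card_unsep_pos[of "p t" "p ` {..<Suc m}" n] range[of t] t by (auto simp: w_def)
    then show "\<kappa> (p t) \<le> \<kappa> (p t) * w (Suc m) t" using later[OF t] by (simp add: mult_le_cancel_left1)
  qed
  also have "\<dots> = 2 * \<eta> (i - 1)"
    using expand[of "Suc m"] \<kappa>[of "Suc m"] less.prems i(3) by simp
  finally have tail: "(\<Sum>t\<in>{Suc m..<n - 1}. \<kappa> (p t)) \<le> 2 * \<eta> (i - 1)" .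
  have "2 * \<eta> i = \<kappa> (p m) * w m m + (\<Sum>t\<in>{Suc m..<n - 1}. \<kappa> (p t) * w m t)"
    using expand[of m] \<kappa>[of m] less.prems by (simp add: i_def sum.atLeast_Suc_lessThan)
  also have "(\<Sum>t\<in>{Suc m..<n - 1}. \<kappa> (p t) * w m t) \<le> (\<Sum>t\<in>{Suc m..<n - 1}. \<kappa> (p t) * K)"
    using later wK by (intro sum_mono mult_left_mono) auto
  also have "\<dots> = K * (\<Sum>t\<in>{Suc m..<n - 1}. \<kappa> (p t))" by (simp add: sum_distrib_left mult.commute)
  also have "\<dots> \<le> K * (2 * \<eta> (i - 1))" using tail K1 by (intro mult_left_mono) auto
  finally have main: "2 * \<eta> i \<le> \<kappa> (p m) * w m m + K * (2 * \<eta> (i - 1))" by simp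
  have gr: "2 * K * \<eta> (i - 1) < \<eta> i" using growth[OF i(1,2)] by (simp add: K_def)
  \<comment> \<open>The sign comes first: replacing the coefficient \<open>w m m\<close> by its
    upper bound \<open>K\<close> is only allowed for a nonnegative gap.\<close>
  have "0 < \<kappa> (p m)"
  proof (rule ccontr)
    assume "\<not> 0 < \<kappa> (p m)"
    then have "\<kappa> (p m) * w m m \<le> 0" by (simp add: w_def mult_nonpos_nonneg)
    then show False using main gr eta_nonneg[OF i(2)] by simp
  qed
  then have "\<kappa> (p m) * w m m \<le> K * \<kappa> (p m)" using wK[of m] by (simp add: mult.commute mult_left_mono)
  then have "K * (2 * \<eta> (i - 1)) < K * \<kappa> (p m)" using main gr by simp
  then show ?case using K1 i(3) by simp
qed

text \<open>The empty cut set is tight for every \<open>\<kappa>\<close>, so the last conclusion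
  excludes it, and the flag starts with one cut point.\<close>

lemma flag_point:
  assumes p: "bij_betw p {..<n - 1} {1..<n}" and f: "f \<subseteq> (\<lambda>m. p ` {..<m}) ` {1..n - 1}"
  obtains \<kappa> where "\<And>c. c \<in> {1..<n} \<Longrightarrow> 0 < \<kappa> c" "feasible \<kappa>"
    "\<And>D. D \<subseteq> {1..<n} \<Longrightarrow> D \<noteq> {} \<Longrightarrow> tight \<kappa> D \<longleftrightarrow> D \<in> f"
proof -
  define flag where "flag = (\<lambda>m. p ` {..<m}) ` {1..n - 1}"
  define val where "val = (\<lambda>\<kappa> D. gap_sum n {} \<kappa> - gap_sum n D \<kappa>)"
  define b where "b = (\<lambda>D :: nat set. 2 * (\<eta> (n - 1) - \<eta> (n - 1 - card D)))"
  have inj: "inj_on p {..<n - 1}" and img: "p ` {..<n - 1} = {1..<n}" using p by (auto simp: bij_betw_def)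
  have range: "p t \<in> {1..<n}" if "t < n - 1" for t using img that by blast
  have cardp: "card (p ` {..<m}) = m" if "m \<le> n - 1" for m
    using card_image[OF inj_on_subset[OF inj, of "{..<m}"]] that by auto
  obtain k0 where k0': "\<And>m. m < n - 1 \<Longrightarrow> gap_sum n (p ` {..<m}) k0 = 2 * \<eta> (n - 1 - m)"
    using gap_sum_solve[OF p, of "\<lambda>m. 2 * \<eta> (n - 1 - m)"] by blast
  have k0: "\<And>m. m \<le> n - 1 \<Longrightarrow> gap_sum n (p ` {..<m}) k0 = 2 * \<eta> (n - 1 - m)"
    subgoal for m using k0'[of m] img by (cases "m = n - 1") (auto simp: eta_0)
    done
  have vp: "2 * \<eta> (n - 2 - m) < k0 (p m)" if "m < n - 1" for m
    using vertex_pos[OF p _ that] k0 by blast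
  have k0pos: "0 < k0 c" if "c \<in> {1..<n}" for c
  proof -
    obtain m where m: "m < n - 1" "c = p m" using img \<open>c \<in> {1..<n}\<close> by (metis imageE lessThan_iff)
    have "0 \<le> \<eta> (n - 2 - m)" using m by (intro eta_nonneg) auto
    then show ?thesis using vp[OF m(1)] m by simp
  qed
  have z: "gap_sum n {} k0 = 2 * \<eta> (n - 1)" using k0[of 0] by simp
  have flag_eq: "val k0 D = b D" if D: "D \<in> flag" for D
    using D k0 cardp z by (auto simp: flag_def val_def b_def)
  \<comment> \<open>Let \<open>m\<close> be the first index with \<open>p m\<close> outside
    \<open>D\<close>. Then \<open>D\<close> properly contains the first \<open>m\<close> values of
    \<open>p\<close>, so it has more than \<open>m\<close> elements. The single gap at
    \<open>p m\<close> already makes \<open>gap_sum n D k0\<close> exceed 2 \<eta> (n - 2 - m),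
    which is at least 2 \<eta> (n - 1 - card D).\<close>
  have off: "val k0 D < b D" if D: "D \<subseteq> {1..<n}" "D \<noteq> {}" "D \<notin> flag" for D
  proof -
    have "\<exists>m<n - 1. p m \<notin> D"
    proof (rule ccontr)
      assume "\<not> ?thesis"
      then have "p ` {..<n - 1} \<subseteq> D" by auto
      then have "D = p ` {..<n - 1}" using D(1) img by auto
      moreover have "1 \<le> n - 1" using D(1,2) by fastforce
      ultimately show False using D(3) by (auto simp: flag_def)
    qed
    then have "\<exists>m. (m < n - 1 \<and> p m \<notin> D) \<and> (\<forall>t<m. \<not> (t < n - 1 \<and> p t \<notin> D))"
      by (subst (asm) exists_least_iff)
    then obtain m where m: "m < n - 1" "p m \<notin> D" "\<And>t. t < m \<Longrightarrow> p t \<in> D"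
      by fastforce
    have sub: "p ` {..<m} \<subseteq> D" using m(3) by auto
    moreover have "p ` {..<m} \<noteq> D"
      using D(2,3) m(1) by (cases "m = 0") (auto simp: flag_def)
    moreover have fD: "finite D" using D(1) finite_subset by blast
    ultimately have "m < card D" using cardp[of m] m(1) by (metis less_imp_le psubsetI psubset_card_mono)
    have pm: "p m \<in> {1..<n}" using range[OF m(1)] .
    have "k0 (p m) * 1 \<le> k0 (p m) * real (card (unsep n D (p m)))"
      using card_unsep_pos[OF m(2) pm] k0pos[OF pm] by (intro mult_left_mono) auto
    also have "\<dots> \<le> gap_sum n D k0"
      unfolding gap_sum_def using pm k0pos
      by (intro member_le_sum[of "p m" "{1..<n}" "\<lambda>c. k0 c * real (card (unsep n D c))"]) (auto simp: less_imp_le)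
    finally have "2 * \<eta> (n - 2 - m) < gap_sum n D k0" using vp[OF m(1)] by simp
    moreover have "\<eta> (n - 1 - card D) \<le> \<eta> (n - 2 - m)"
      using \<open>m < card D\<close> m(1) by (intro eta_mono) auto
    ultimately show ?thesis using z by (simp add: val_def b_def)
  qed
  define r where "r = (\<lambda>m. if p ` {..<m} \<in> f then 0 else 1 :: real)"
  \<comment> \<open>The direction must satisfy \<open>val y D = - r m\<close> for the flag member
    \<open>D\<close> with \<open>m\<close> cut points. For the full cut set the gap sum is 0, which
    forces the value \<open>- r (n - 1)\<close> for \<open>gap_sum n {} y\<close>; the other
    right-hand sides follow by subtraction.\<close>
  obtain y where y': "\<And>m. m < n - 1 \<Longrightarrow> gap_sum n (p ` {..<m}) y = (if m = 0 then - r (n - 1) else r m - r (n - 1))"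
    using gap_sum_solve[OF p, of "\<lambda>m. if m = 0 then - r (n - 1) else r m - r (n - 1)"] by blast
  have vy: "val y (p ` {..<m}) = - r m" if "m \<in> {1..n - 1}" for m
    using y'[of m] y'[of 0] that img by (cases "m = n - 1") (auto simp: val_def)
  have valadd: "val (\<lambda>c. k0 c + t * y c) D = val k0 D + t * val y D" for t D
    by (simp add: val_def gap_sum_add algebra_simps)
  have "\<forall>\<^sub>F t in at_right (0::real). (\<forall>c\<in>{1..<n}. 0 < k0 c + t * y c) \<and>
     (\<forall>D\<in>{D. D \<subseteq> {1..<n} \<and> D \<noteq> {} \<and> D \<notin> flag}. val k0 D + t * val y D < b D)"
  proof (intro eventually_conj eventually_ball_finite ballI)
    fix c assume c: "c \<in> {1..<n}"
    have "((\<lambda>t. k0 c + t * y c) \<longlongrightarrow> k0 c + 0 * y c) (at_right 0)" by (intro tendsto_intros)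
    then show "\<forall>\<^sub>F t in at_right 0. 0 < k0 c + t * y c"
      using k0pos[OF c] by (intro order_tendstoD(1)) auto
  next
    fix D assume D: "D \<in> {D. D \<subseteq> {1..<n} \<and> D \<noteq> {} \<and> D \<notin> flag}"
    have "((\<lambda>t. val k0 D + t * val y D) \<longlongrightarrow> val k0 D + 0 * val y D) (at_right 0)" by (intro tendsto_intros)
    then show "\<forall>\<^sub>F t in at_right 0. val k0 D + t * val y D < b D"
      using off[of D] D by (intro order_tendstoD(2)) auto
  qed auto
  then have "\<forall>\<^sub>F t in at_right (0::real). 0 < t \<and> (\<forall>c\<in>{1..<n}. 0 < k0 c + t * y c) \<and>
     (\<forall>D\<in>{D. D \<subseteq> {1..<n} \<and> D \<noteq> {} \<and> D \<notin> flag}. val k0 D + t * val y D < b D)"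
    by (rule eventually_conj[OF eventually_at_right_less])
  from eventually_happens'[OF _ this] obtain t :: real where t: "0 < t" "\<And>c. c \<in> {1..<n} \<Longrightarrow> 0 < k0 c + t * y c"
     "\<And>D. D \<subseteq> {1..<n} \<Longrightarrow> D \<noteq> {} \<Longrightarrow> D \<notin> flag \<Longrightarrow> val k0 D + t * val y D < b D"
    by auto
  let ?k = "\<lambda>c. k0 c + t * y c"
  have cmp: "val ?k D \<le> b D \<and> (val ?k D = b D \<longleftrightarrow> D \<in> f)" if D: "D \<subseteq> {1..<n}" "D \<noteq> {}" for D
  proof (cases "D \<in> flag")
    case True
    then obtain m where m: "m \<in> {1..n - 1}" "D = p ` {..<m}" by (auto simp: flag_def)
    have "val ?k D = b D - t * r m" using flag_eq[OF True] vy[OF m(1)] m(2) by (simp add: valadd)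
    then show ?thesis using t(1) m(2) by (auto simp: r_def)
  next
    case False
    then have "D \<notin> f" using f by (auto simp: flag_def)
    then show ?thesis using t(3)[OF D False] by (simp add: valadd)
  qed
  show ?thesis
  proof
    show "0 < ?k c" if "c \<in> {1..<n}" for c using t(2) that .
    show "feasible ?k"
      unfolding feasible_def
    proof (intro conjI ballI allI impI)
      fix D assume D: "D \<subseteq> {1..<n}"
      show "gap_sum n {} ?k - gap_sum n D ?k \<le> 2 * (\<eta> (n - 1) - \<eta> (n - 1 - card D))"
        using cmp[OF D] by (cases "D = {}") (auto simp: val_def b_def)
    qed (use t(2) in \<open>auto intro: less_imp_le\<close>)
    show "tight ?k D \<longleftrightarrow> D \<in> f" if "D \<subseteq> {1..<n}" "D \<noteq> {}" for D
      using cmp[OF that] by (auto simp: tight_def val_def b_def)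
  qed
qed

end

section \<open>Faces of a polytope with prescribed tight sets\<close>

text \<open>The members of \<open>\<F>\<close> are the tight sets of points of \<open>P\<close>, and
  each point is in the relative interior of the face given by its tight set. As distinct faces have
  disjoint relative interiors, the nonempty faces correspond to \<open>\<F>\<close>. Dimensions come
  from counting: each added tight inequality lowers the dimension, which can happen \<open>N\<close>
  times between at most \<open>N\<close> and at least 0, so it drops by exactly one each
  time.\<close>

lemma card_faces_of_codim:
  fixes V :: "'a::euclidean_space set" and v :: "'i \<Rightarrow> 'a" and b :: "'i \<Rightarrow> real"
  assumes V: "affine V" and dimV: "aff_dim V \<le> int N" and I: "finite I"
    and P: "P = {x \<in> V. \<forall>i\<in>I. x \<bullet> v i \<le> b i}"
    and tights: "\<And>x. x \<in> P \<Longrightarrow> {i \<in> I. x \<bullet> v i = b i} \<in> \<F>"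
    and realized: "\<And>f. f \<in> \<F> \<Longrightarrow> \<exists>x\<in>P. {i \<in> I. x \<bullet> v i = b i} = f"
    and empty: "{} \<in> \<F>"
    and down: "\<And>f g. f \<in> \<F> \<Longrightarrow> g \<subseteq> f \<Longrightarrow> g \<in> \<F>"
    and ext: "\<And>f. f \<in> \<F> \<Longrightarrow> \<exists>g\<in>\<F>. f \<subseteq> g \<and> card g = N"
    and c: "c \<le> N"
  shows "card (faces_of_codim P c) = card {f \<in> \<F>. card f = c}"
proof -
  define tight where "tight = (\<lambda>x. {i \<in> I. x \<bullet> v i = b i})"
  define face where "face = (\<lambda>f. {x \<in> P. \<forall>i\<in>f. x \<bullet> v i = b i})"
  have FI: "f \<subseteq> I" if "f \<in> \<F>" for f using realized[OF that] by auto
  have Ffin: "finite f" if "f \<in> \<F>" for f using FI[OF that] I finite_subset by blast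
  have "P = V \<inter> (\<Inter>i\<in>I. {x. v i \<bullet> x \<le> b i})" by (auto simp: P inner_commute)
  moreover have "convex (V \<inter> (\<Inter>i\<in>I. {x. v i \<bullet> x \<le> b i}))"
    by (intro convex_Int affine_imp_convex[OF V] convex_INT convex_halfspace_le)
  ultimately have cP: "convex P" by simp
  have face_face: "face f face_of P" if "f \<in> \<F>" for f
    using Ffin[OF that] FI[OF that]
  proof (induction f)
    case empty
    have "face {} = P" by (auto simp: face_def)
    then show ?case using face_of_refl[OF cP] by simp
  next
    case (insert i f)
    have "P \<inter> {x. v i \<bullet> x = b i} face_of P"
      using insert.prems cP by (intro face_of_Int_supporting_hyperplane_le) (auto simp: P inner_commute)
    moreover have "face (insert i f) = face f \<inter> (P \<inter> {x. v i \<bullet> x = b i})"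
      by (auto simp: face_def inner_commute)
    ultimately show ?case using insert by (simp add: face_of_Int)
  qed
  \<comment> \<open>All points of the affine hull satisfy the equations of \<open>tight x\<close>,
    and near \<open>x\<close> the other inequalities stay strict.\<close>
  have rel: "x \<in> rel_interior (face (tight x))" if x: "x \<in> P" for x
  proof -
    define H where "H = V \<inter> (\<Inter>i\<in>tight x. {y. v i \<bullet> y = b i})"
    define U where "U = (\<Inter>i\<in>I - tight x. {y. v i \<bullet> y < b i})"
    have "affine H" unfolding H_def using V by (intro affine_Int affine_Inter) (auto simp: affine_hyperplane)
    moreover have "face (tight x) \<subseteq> H" by (auto simp: face_def H_def P inner_commute)
    ultimately have hull: "affine hull (face (tight x)) \<subseteq> H" by (simp add: hull_minimal)
    have "open U" unfolding U_def using I by (intro open_INT) (auto simp: open_halfspace_lt)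
    moreover have "x \<in> U" using x by (auto simp: U_def P tight_def inner_commute less_le)
    ultimately obtain e where e: "0 < e" "ball x e \<subseteq> U" using open_contains_ball by blast
    have "ball x e \<inter> affine hull (face (tight x)) \<subseteq> face (tight x)"
    proof
      fix y assume y: "y \<in> ball x e \<inter> affine hull (face (tight x))"
      then have "y \<in> H" "y \<in> U" using hull e by auto
      then have "y \<in> V" "\<And>i. i \<in> tight x \<Longrightarrow> y \<bullet> v i = b i" "\<And>i. i \<in> I - tight x \<Longrightarrow> y \<bullet> v i < b i"
        by (auto simp: H_def U_def inner_commute)
      then show "y \<in> face (tight x)" unfolding face_def P by (auto simp: less_imp_le) (metis DiffI less_imp_le order_refl)
    qed
    moreover have "x \<in> face (tight x)" using x by (auto simp: face_def tight_def)
    ultimately show ?thesis using e(1) by (auto simp: mem_rel_interior_ball)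
  qed
  have face_inj: "f \<subseteq> g" if fg: "f \<in> \<F>" "g \<in> \<F>" "face g \<subseteq> face f" for f g
  proof -
    obtain x where x: "x \<in> P" "tight x = g" using realized[OF fg(2)] by (auto simp: tight_def)
    then have "x \<in> face g" by (auto simp: face_def tight_def)
    then have "x \<in> face f" using fg by auto
    then show ?thesis using x FI[OF fg(1)] by (auto simp: face_def tight_def)
  qed
  have step: "aff_dim (face g) + int (card g) \<le> aff_dim (face f) + int (card f)"
    if "f \<in> \<F>" "g \<in> \<F>" "f \<subseteq> g" for f g
    using Ffin[OF that(2)] that
  proof (induction "card (g - f)" arbitrary: f)
    case 0
    then have "f = g" by auto
    then show ?case by simp
  next
    case (Suc k)
    from Suc.hyps(2) have "card (g - f) \<noteq> 0" by simp
    then obtain i where i: "i \<in> g - f" by (metis card.empty ex_in_conv)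
    let ?f = "insert i f"
    have f: "?f \<in> \<F>" using down[OF Suc.prems(3), of ?f] i Suc.prems by auto
    have finf: "finite f" using Ffin Suc.prems by blast
    have "k = card (g - ?f)" using Suc.hyps(2) i Suc.prems(1) by (simp add: card_Diff_insert)
    then have IH: "aff_dim (face g) + int (card g) \<le> aff_dim (face ?f) + int (card ?f)"
      using Suc.hyps(1)[OF _ Suc.prems(1) f Suc.prems(3)] i Suc.prems(4) by auto
    have "face ?f = face f \<inter> face ?f" by (auto simp: face_def)
    then have "face ?f face_of face f"
      using face_of_subset[OF face_face[OF f], of "face f"] face_of_imp_subset[OF face_face[OF Suc.prems(2)]] by blast
    \<comment> \<open>A point whose tight set is exactly \<open>f\<close> lies in the larger face
      only.\<close>
    moreover have "face ?f \<noteq> face f" using face_inj[OF f Suc.prems(2)] i by auto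
    moreover have "convex (face f)" using face_face[OF Suc.prems(2)] face_of_imp_convex by blast
    ultimately have "aff_dim (face ?f) < aff_dim (face f)" by (metis face_of_aff_dim_lt)
    then show ?case using IH i finf by simp
  qed
  have ne: "face f \<noteq> {}" if "f \<in> \<F>" for f
    using realized[OF that] by (auto simp: face_def)
  have dim_ge: "int N - int (card f) \<le> aff_dim (face f)" if f: "f \<in> \<F>" for f
  proof -
    obtain g where g: "g \<in> \<F>" "f \<subseteq> g" "card g = N" using ext[OF f] by auto
    have "0 \<le> aff_dim (face g)" using ne[OF g(1)] by (metis aff_dim_negative_iff linorder_not_less)
    then show ?thesis using step[OF f g(1,2)] g(3) by simp
  qed
  have dim_le: "aff_dim (face f) \<le> int N - int (card f)" if f: "f \<in> \<F>" for f
  proof -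
    have "aff_dim (face {}) \<le> int N"
      using aff_dim_subset[of "face {}" V] dimV by (auto simp: face_def P)
    then show ?thesis using step[OF down[OF f empty_subsetI] f] by simp
  qed
  have dim: "aff_dim (face f) = int N - int (card f)" if "f \<in> \<F>" for f
    using dim_ge[OF that] dim_le[OF that] by simp
  have "face {} = P" by (auto simp: face_def)
  then have dimP: "aff_dim P = int N" using dim[OF empty] by simp
  have "faces_of_codim P c = face ` {f \<in> \<F>. card f = c}"
  proof (intro equalityI subsetI)
    fix F assume F: "F \<in> faces_of_codim P c"
    then have FP: "F face_of P" and codim: "aff_dim P - aff_dim F = int c" by (auto simp: faces_of_codim_def)
    \<comment> \<open>The empty face has codimension \<open>N + 1\<close>, which
      \<open>c \<le> N\<close> rules out.\<close>
    have "F \<noteq> {}"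
    proof
      assume "F = {}"
      then show False using codim c dimP by simp
    qed
    then obtain x where x: "x \<in> rel_interior F"
      using face_of_imp_convex[OF FP] rel_interior_eq_empty by blast
    then have "x \<in> P" using rel_interior_subset face_of_imp_subset[OF FP] by blast
    then have t: "tight x \<in> \<F>" using tights by (simp add: tight_def)
    have "F = face (tight x)"
      using face_of_eq[OF FP face_face[OF t]] x rel[OF \<open>x \<in> P\<close>] by blast
    moreover have "card (tight x) = c" using codim dimP dim[OF t] calculation by auto
    ultimately show "F \<in> face ` {f \<in> \<F>. card f = c}" using t by auto
  next
    fix F assume "F \<in> face ` {f \<in> \<F>. card f = c}"
    then obtain f where f: "f \<in> \<F>" "card f = c" "F = face f" by auto
    then show "F \<in> faces_of_codim P c"
      using face_face[OF f(1)] dim[OF f(1)] dimP f by (auto simp: faces_of_codim_def)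
  qed
  moreover have "inj_on face {f \<in> \<F>. card f = c}"
    using face_inj by (intro inj_onI) (auto intro!: antisym)
  ultimately show ?thesis by (simp add: card_image)
qed

section \<open>Chains of subsets and their normal vectors\<close>

definition set_chains :: "'a set set set" where
  "set_chains = {C. C \<noteq> {} \<and> {} \<notin> C \<and> UNIV \<notin> C \<and> (\<forall>A\<in>C. \<forall>B\<in>C. A \<subseteq> B \<or> B \<subseteq> A)}"

definition sep :: "'a set set \<Rightarrow> ('a \<times> 'a) set" where
  "sep C = {(i, j). \<exists>A\<in>C. i \<in> A \<and> j \<notin> A}"

text \<open>For initial segments of the standard order this is \<delta> minus the half sum belonging
  to the simple roots that are not cut; the remaining chains give the images of these vectors under
  the Weyl group.\<close>

definition normal :: "'n::finite set set \<Rightarrow> real ^ 'n" where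
  "normal C = (1/2) *\<^sub>R (\<Sum>(i, j)\<in>sep C. axis i 1 - axis j 1)"

definition tops :: "('a \<Rightarrow> real) \<Rightarrow> 'a set set \<Rightarrow> bool" where
  "tops x C \<longleftrightarrow> (\<forall>A\<in>C. \<forall>i\<in>A. \<forall>j\<in>-A. x j \<le> x i)"

definition seg :: "(nat \<Rightarrow> 'a) \<Rightarrow> nat set \<Rightarrow> 'a set set" where
  "seg e D = (\<lambda>c. e ` {..<c}) ` D"

lemma inner_normal: "x \<bullet> normal C = (\<Sum>(i, j)\<in>sep C. x $ i - x $ j) / 2"
  by (simp add: normal_def inner_sum_right case_prod_unfold inner_diff_right inner_axis)

lemma sum_fst_eq:
  assumes "finite S"
  shows "(\<Sum>z\<in>S. if p = fst z then 1 else 0) = real (card (S `` {p}))"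
proof -
  have "{z \<in> S. p = fst z} = Pair p ` (S `` {p})" by auto
  then have "card {z \<in> S. p = fst z} = card (S `` {p})" by (simp add: card_image inj_on_def)
  then show ?thesis using assms by (simp add: sum.If_cases Int_def)
qed

lemma sum_snd_eq:
  assumes "finite S"
  shows "(\<Sum>z\<in>S. if p = snd z then 1 else 0) = real (card (S\<inverse> `` {p}))"
proof -
  have "{z \<in> S. p = snd z} = (\<lambda>q. (q, p)) ` (S\<inverse> `` {p})" by auto
  then have "card {z \<in> S. p = snd z} = card (S\<inverse> `` {p})" by (simp add: card_image inj_on_def)
  then show ?thesis using assms by (simp add: sum.If_cases Int_def)
qed

lemma normal_nth:
  "normal C $ p = (real (card (sep C `` {p})) - real (card ((sep C)\<inverse> `` {p}))) / 2"
  by (simp add: normal_def case_prod_unfold axis_def sum_subtractf sum_fst_eq sum_snd_eq diff_divide_distrib)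

section \<open>Permuting chains and the rearrangement argument\<close>

lemma sep_image: "bij \<sigma> \<Longrightarrow> sep ((`) \<sigma> ` C) = map_prod \<sigma> \<sigma> ` sep C"
proof (intro equalityI subsetI)
  fix z assume b: "bij \<sigma>" and z: "z \<in> sep ((`) \<sigma> ` C)"
  obtain i j where e: "z = (\<sigma> i, \<sigma> j)" using b by (metis bij_pointE surj_pair)
  then have "(i, j) \<in> sep C" using z b by (auto simp: sep_def bij_def inj_image_mem_iff inj_eq)
  then show "z \<in> map_prod \<sigma> \<sigma> ` sep C" using e by auto
next
  fix z assume "bij \<sigma>" "z \<in> map_prod \<sigma> \<sigma> ` sep C"
  then show "z \<in> sep ((`) \<sigma> ` C)" by (auto simp: sep_def bij_def inj_eq inj_image_mem_iff)
qed

lemma inner_normal_image: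
  assumes "bij \<sigma>"
  shows "x \<bullet> normal ((`) \<sigma> ` C) = (\<chi> i. x $ \<sigma> i) \<bullet> normal C"
proof -
  have "inj (map_prod \<sigma> \<sigma>)" using assms by (simp add: prod.inj_map bij_is_inj)
  then have "inj_on (map_prod \<sigma> \<sigma>) (sep C)" by (rule inj_on_subset) simp
  then show ?thesis
    by (simp add: inner_normal sep_image[OF assms] sum.reindex case_prod_unfold)
qed

lemma set_chains_image: "bij \<sigma> \<Longrightarrow> C \<in> set_chains \<Longrightarrow> (`) \<sigma> ` C \<in> set_chains"
proof -
  assume b: "bij \<sigma>" and C: "C \<in> set_chains"
  have "UNIV \<noteq> \<sigma> ` A" if "A \<in> C" for A
  proof
    assume "UNIV = \<sigma> ` A"
    then have "\<sigma> ` A = \<sigma> ` UNIV" using b by (simp add: bij_def)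
    then have "A = UNIV" using b by (simp only: inj_image_eq_iff bij_is_inj)
    then show False using that C by (simp add: set_chains_def)
  qed
  moreover have "\<sigma> ` A \<subseteq> \<sigma> ` B \<or> \<sigma> ` B \<subseteq> \<sigma> ` A" if "A \<in> C" "B \<in> C" for A B
  proof -
    have "A \<subseteq> B \<or> B \<subseteq> A" using C that by (simp add: set_chains_def)
    then show ?thesis by (metis image_mono)
  qed
  ultimately show ?thesis using C by (auto simp: set_chains_def)
qed

lemma card_image_image: "bij \<sigma> \<Longrightarrow> card ((`) \<sigma> ` C) = card C"
  by (intro card_image inj_onI) (metis bij_is_inj inj_image_eq_iff)

text \<open>The rearrangement inequality for one transposition. Every member containing
  \<open>j\<close> must contain \<open>A\<close> and hence \<open>i\<close>, so
  \<open>normal C\<close> is larger at \<open>i\<close> than at \<open>j\<close>, opposite to the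
  order of \<open>x\<close>. Exchanging \<open>i\<close> and \<open>j\<close> in the chain gains the
  product of the two differences.\<close>

lemma swap_increases:
  fixes x :: "real ^ 'n::finite"
  assumes C: "C \<in> set_chains" and A: "A \<in> C" "i \<in> A" "j \<notin> A" and lt: "x $ i < x $ j"
  obtains C' where "C' \<in> set_chains" "card C' = card C" "x \<bullet> normal C < x \<bullet> normal C'"
proof
  define \<tau> where "\<tau> = Transposition.transpose i j"
  have b: "bij \<tau>" by (simp add: \<tau>_def)
  show "(`) \<tau> ` C \<in> set_chains" "card ((`) \<tau> ` C) = card C"
    using set_chains_image[OF b C] card_image_image[OF b] by auto
  have cmp: "A \<subseteq> B \<or> B \<subseteq> A" if "B \<in> C" for B using C A(1) that by (auto simp: set_chains_def)
  have "sep C `` {j} \<subset> sep C `` {i}"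
  proof (rule psubsetI)
    show "sep C `` {j} \<subseteq> sep C `` {i}"
    proof
      fix q assume "q \<in> sep C `` {j}"
      then obtain B where B: "B \<in> C" "j \<in> B" "q \<notin> B" by (auto simp: sep_def)
      then have "i \<in> B" using cmp[OF B(1)] A by auto
      then show "q \<in> sep C `` {i}" using B by (auto simp: sep_def)
    qed
    have "j \<in> sep C `` {i}" "j \<notin> sep C `` {j}" using A by (auto simp: sep_def)
    then show "sep C `` {j} \<noteq> sep C `` {i}" by auto
  qed
  then have 1: "card (sep C `` {j}) < card (sep C `` {i})" by (intro psubset_card_mono) auto
  have "(sep C)\<inverse> `` {i} \<subseteq> (sep C)\<inverse> `` {j}"
  proof
    fix q assume "q \<in> (sep C)\<inverse> `` {i}"
    then obtain B where B: "B \<in> C" "q \<in> B" "i \<notin> B" by (auto simp: sep_def)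
    then have "j \<notin> B" using cmp[OF B(1)] A by auto
    then show "q \<in> (sep C)\<inverse> `` {j}" using B by (auto simp: sep_def)
  qed
  then have 2: "card ((sep C)\<inverse> `` {i}) \<le> card ((sep C)\<inverse> `` {j})" by (intro card_mono) auto
  have nn: "normal C $ j < normal C $ i" using 1 2 by (simp add: normal_nth)
  have ij: "i \<noteq> j" using A by auto
  have "x \<bullet> normal ((`) \<tau> ` C) - x \<bullet> normal C = (\<Sum>p\<in>UNIV. (x $ \<tau> p - x $ p) * normal C $ p)"
    unfolding inner_normal_image[OF b] by (simp add: inner_vec_def sum_subtractf left_diff_distrib)
  also have "\<dots> = (\<Sum>p\<in>{i, j}. (x $ \<tau> p - x $ p) * normal C $ p)"
    by (rule sum.mono_neutral_right) (auto simp: \<tau>_def Transposition.transpose_def)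
  also have "\<dots> = (x $ j - x $ i) * (normal C $ i - normal C $ j)"
    using ij by (simp add: \<tau>_def algebra_simps)
  also have "\<dots> > 0" using lt nn by simp
  finally show "x \<bullet> normal C < x \<bullet> normal ((`) \<tau> ` C)" by simp
qed

text \<open>A maximizer among the finitely many chains of the same length admits no improving
  exchange, so it follows the order of the coordinates. Chains of equal length share their bound;
  hence the chains that follow the order decide feasibility.\<close>

lemma tops_maximizer:
  fixes x :: "real ^ 'n::finite"
  assumes C: "C \<in> set_chains"
  obtains C' where "C' \<in> set_chains" "card C' = card C" "tops (($) x) C'"
    "x \<bullet> normal C \<le> x \<bullet> normal C'" "\<not> tops (($) x) C \<Longrightarrow> x \<bullet> normal C < x \<bullet> normal C'"
proof -
  let ?S = "{D :: 'n set set. D \<in> set_chains \<and> card D = card C}"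
  have "finite ?S" by (rule finite)
  moreover have "C \<in> ?S" using C by auto
  ultimately have fin: "finite ((\<lambda>D. x \<bullet> normal D) ` ?S)" "(\<lambda>D. x \<bullet> normal D) ` ?S \<noteq> {}" by auto
  obtain C' where C': "C' \<in> ?S" "Max ((\<lambda>D. x \<bullet> normal D) ` ?S) = x \<bullet> normal C'"
    using Max_in[OF fin] by (rule imageE)
  have C'max: "x \<bullet> normal D \<le> x \<bullet> normal C'" if "D \<in> ?S" for D
    using Max_ge[OF fin(1) imageI[OF that]] C'(2) by simp
  have max: "tops (($) x) C'"
  proof (rule ccontr)
    assume "\<not> ?thesis"
    then obtain A i j where "A \<in> C'" "i \<in> A" "j \<notin> A" "x $ i < x $ j" by (auto simp: tops_def not_le)
    with C'(1) swap_increases[of C' A i j x] obtain D where "D \<in> ?S" "x \<bullet> normal C' < x \<bullet> normal D" by auto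
    then show False using C'max[of D] by simp
  qed
  have "x \<bullet> normal C < x \<bullet> normal C'" if "\<not> tops (($) x) C"
  proof -
    from that obtain A i j where "A \<in> C" "i \<in> A" "j \<notin> A" "x $ i < x $ j" by (auto simp: tops_def not_le)
    with C swap_increases[of C A i j x] obtain D where "D \<in> ?S" "x \<bullet> normal C < x \<bullet> normal D" by auto
    then show ?thesis using C'max[of D] by simp
  qed
  then show ?thesis using that C' C'max max \<open>C \<in> ?S\<close> by blast
qed

section \<open>Enumerations adapted to a chain\<close>

lemma antitone_enumeration:
  fixes g :: "'a \<Rightarrow> real"
  assumes "finite X"
  obtains p where "bij_betw p {..<card X} X" "\<And>i j. i < j \<Longrightarrow> j < card X \<Longrightarrow> g (p j) \<le> g (p i)"
proof -
  obtain xs where xs: "set xs = X" "distinct xs" using finite_distinct_list[OF assms] by auto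
  let ?ys = "sort_key (\<lambda>a. - g a) xs"
  have len: "length ?ys = card X" using xs by (simp add: distinct_card[symmetric])
  show ?thesis
  proof
    show "bij_betw ((!) ?ys) {..<card X} X" using xs len by (intro bij_betw_nth) auto
    show "g (?ys ! j) \<le> g (?ys ! i)" if "i < j" "j < card X" for i j
      using sorted_sort_key[of "\<lambda>a. - g a" xs] that len by (auto simp: sorted_iff_nth_mono)
  qed
qed

lemma initial_segment:
  fixes g :: "'a \<Rightarrow> real"
  assumes p: "bij_betw p {..<card X} X" and anti: "\<And>i j. i < j \<Longrightarrow> j < card X \<Longrightarrow> g (p j) \<le> g (p i)"
    and A: "A \<subseteq> X" and gt: "\<And>a b. a \<in> A \<Longrightarrow> b \<in> X - A \<Longrightarrow> g b < g a"
  shows "A = p ` {..<card A}"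
proof -
  define Q where "Q = {i \<in> {..<card X}. p i \<in> A}"
  define m where "m = (LEAST m. m \<notin> Q)"
  have img: "A = p ` Q" using p A by (auto simp: Q_def bij_betw_def)
  have "finite Q" by (simp add: Q_def)
  then have "\<exists>m. m \<notin> Q" using ex_new_if_finite[of Q] by simp
  then have m: "m \<notin> Q" "\<And>i. i < m \<Longrightarrow> i \<in> Q" unfolding m_def by (rule LeastI_ex) (use not_less_Least in blast)
  have "i < m" if i: "i \<in> Q" for i
  proof (rule ccontr)
    assume "\<not> i < m"
    then have "m < i" using i m(1) by (metis linorder_neqE_nat)
    moreover have "i < card X" "p i \<in> A" using i by (auto simp: Q_def)
    ultimately have "p m \<in> X - A" "g (p i) \<le> g (p m)" using m(1) p anti by (auto simp: Q_def bij_betw_def)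
    then show False using gt[OF \<open>p i \<in> A\<close>] by fastforce
  qed
  then have Q: "Q = {..<m}" using m(2) by auto
  have "inj_on p Q" using p by (auto simp: Q_def bij_betw_def inj_on_def)
  then have "card A = m" using img Q by (simp add: card_image)
  then show ?thesis using img Q by simp
qed

text \<open>Adding to \<open>x\<close> the number of chain members that contain a point makes each of these an initial
  segment, without disturbing the order of the values of \<open>x\<close>.\<close>

lemma chain_enumeration:
  fixes x :: "'a \<Rightarrow> real"
  assumes X: "finite X" and C: "C \<subseteq> Pow X" "\<And>A B. A \<in> C \<Longrightarrow> B \<in> C \<Longrightarrow> A \<subseteq> B \<or> B \<subseteq> A"
    and tops: "\<And>A a b. A \<in> C \<Longrightarrow> a \<in> A \<Longrightarrow> b \<in> X - A \<Longrightarrow> x b \<le> x a"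
  obtains p where "bij_betw p {..<card X} X" "\<And>i j. i < j \<Longrightarrow> j < card X \<Longrightarrow> x (p j) \<le> x (p i)"
    "\<And>A. A \<in> C \<Longrightarrow> A = p ` {..<card A}"
proof -
  define r where "r = (\<lambda>a. card {A \<in> C. a \<in> A})"
  define g where "g = (\<lambda>a. x a + real (r a))"
  have finC: "finite C" using X C(1) by (meson finite_Pow_iff finite_subset)
  obtain p where p: "bij_betw p {..<card X} X" "\<And>i j. i < j \<Longrightarrow> j < card X \<Longrightarrow> g (p j) \<le> g (p i)"
    using antitone_enumeration[OF X] by metis
  have gx: "x b \<le> x a" if ab: "a \<in> X" "b \<in> X" "g b \<le> g a" for a b
  proof (rule ccontr)
    assume lt: "\<not> x b \<le> x a"
    then have "{A \<in> C. a \<in> A} \<subseteq> {A \<in> C. b \<in> A}" using tops ab by fastforce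
    then have "r a \<le> r b" unfolding r_def using finC by (intro card_mono) auto
    then show False using lt ab(3) by (simp add: g_def)
  qed
  have "g b < g a" if "A \<in> C" "a \<in> A" "b \<in> X - A" for A a b
  proof -
    have "{A \<in> C. b \<in> A} \<subset> {A \<in> C. a \<in> A}" using C(2)[OF that(1)] that by blast
    then have "r b < r a" unfolding r_def using finC by (intro psubset_card_mono) auto
    then show ?thesis using tops[OF that] by (simp add: g_def)
  qed
  then have "A = p ` {..<card A}" if "A \<in> C" for A
    using initial_segment[where g = g, OF p, of A] that C(1) by blast
  moreover have "x (p j) \<le> x (p i)" if "i < j" "j < card X" for i j
    using p that by (intro gx) (auto simp: bij_betw_def)
  ultimately show ?thesis using that p(1) by blast
qed

section \<open>Chains of initial segments of an enumeration\<close>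

context
  fixes e :: "nat \<Rightarrow> 'n::finite" and n :: nat
  assumes n: "n = CARD('n)" and e: "bij_betw e {..<n} UNIV"
begin

lemma enum_inj: "inj_on e {..<n}" and enum_ex: "\<exists>i<n. e i = v"
  using e by (auto simp: bij_betw_def) (metis UNIV_I imageE lessThan_iff)

lemma enum_mem_iff: "i < n \<Longrightarrow> c \<le> n \<Longrightarrow> e i \<in> e ` {..<c} \<longleftrightarrow> i < c"
  using inj_on_image_mem_iff[OF enum_inj, of i "{..<c}"] by auto

lemma card_enum_image: "c \<le> n \<Longrightarrow> card (e ` {..<c}) = c"
  using card_image[OF inj_on_subset[OF enum_inj, of "{..<c}"]] by auto

lemma card_seg: "D \<subseteq> {1..<n} \<Longrightarrow> card (seg e D) = card D"
  unfolding seg_def by (intro card_image inj_onI) (metis atLeastLessThan_iff card_enum_image less_imp_le subsetD)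

lemma seg_in_set_chains:
  assumes D: "D \<subseteq> {1..<n}" "D \<noteq> {}"
  shows "seg e D \<in> set_chains"
proof -
  have "UNIV \<noteq> e ` {..<c}" if "c \<in> D" for c
    using card_enum_image[of c] that D n by (metis atLeastLessThan_iff less_imp_le less_irrefl subsetD)
  moreover have "{..<c} \<noteq> {}" if "c \<in> D" for c using that D by (force simp: lessThan_empty_iff)
  moreover have "e ` {..<c} \<subseteq> e ` {..<d} \<or> e ` {..<d} \<subseteq> e ` {..<c}" for c d
    by (metis image_mono lessThan_subset_iff linorder_le_cases)
  ultimately show ?thesis using D(2) by (auto simp: set_chains_def seg_def)
qed

lemma chain_eq_seg:
  assumes C: "C \<in> set_chains" and init: "\<And>A. A \<in> C \<Longrightarrow> A = e ` {..<card A}"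
  shows "card ` C \<subseteq> {1..<n}" "card ` C \<noteq> {}" "C = seg e (card ` C)"
proof -
  have "card A \<in> {1..<n}" if "A \<in> C" for A
  proof -
    have "A \<noteq> {}" "A \<subset> UNIV" using that C by (auto simp: set_chains_def)
    then show ?thesis using psubset_card_mono[of UNIV A] n by (simp add: Suc_le_eq card_gt_0_iff)
  qed
  then show "card ` C \<subseteq> {1..<n}" by auto
  show "card ` C \<noteq> {}" using C by (simp add: set_chains_def)
  show "C = seg e (card ` C)" using init by (force simp: seg_def image_image)
qed

lemma sep_seg:
  assumes D: "D \<subseteq> {1..<n}"
  shows "sep (seg e D) = map_prod e e ` {(i, j). i < n \<and> j < n \<and> (\<exists>d\<in>D. i < d \<and> d \<le> j)}"
    (is "_ = map_prod e e ` ?S")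
proof (intro equalityI subsetI)
  fix z assume z: "z \<in> sep (seg e D)"
  obtain i j where ij: "z = (e i, e j)" "i < n" "j < n" by (metis enum_ex surj_pair)
  from z ij obtain d where d: "d \<in> D" "e i \<in> e ` {..<d}" "e j \<notin> e ` {..<d}" by (auto simp: sep_def seg_def)
  then have "d \<le> n" using D by auto
  then have "i < d" "d \<le> j" using d ij enum_mem_iff by (auto simp: not_less)
  then have "(i, j) \<in> ?S" using ij d by auto
  then show "z \<in> map_prod e e ` ?S" using ij by auto
next
  fix z assume "z \<in> map_prod e e ` ?S"
  then obtain i j d where d: "z = (e i, e j)" "i < n" "j < n" "d \<in> D" "i < d" "d \<le> j" by auto
  then have "d \<le> n" using D by auto
  then have "e i \<in> e ` {..<d}" "e j \<notin> e ` {..<d}" using d enum_mem_iff by auto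
  then show "z \<in> sep (seg e D)" using d by (auto simp: sep_def seg_def)
qed

lemma diff_eq_sum_gaps:
  fixes y :: "nat \<Rightarrow> real"
  shows "i \<le> j \<Longrightarrow> y i - y j = (\<Sum>c\<in>{i<..j}. y (c - 1) - y c)"
proof (induction j)
  case (Suc j)
  show ?case
  proof (cases "i = Suc j")
    case False
    then have "{i<..Suc j} = insert (Suc j) {i<..j}" using Suc.prems by auto
    then show ?thesis using Suc False by simp
  qed simp
qed simp

text \<open>Each difference over a separated pair telescopes into the gaps at the cuts between its
  two indices. After exchanging the sums, the gap at \<open>c\<close> is counted once for every pair
  around \<open>c\<close> that some cut point in \<open>D\<close> separates, that is, for the pairs
  in \<open>unsep n {} c\<close> outside \<open>unsep n D c\<close>.\<close>

lemma inner_normal_seg: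
  fixes x :: "real ^ 'n"
  assumes D: "D \<subseteq> {1..<n}"
  defines "\<kappa> \<equiv> \<lambda>c. x $ e (c - 1) - x $ e c"
  shows "x \<bullet> normal (seg e D) = (gap_sum n {} \<kappa> - gap_sum n D \<kappa>) / 2"
proof -
  let ?S = "{(i, j). i < n \<and> j < n \<and> (\<exists>d\<in>D. i < d \<and> d \<le> j)}"
  have finS: "finite ?S" by (rule finite_subset[of _ "{..<n} \<times> {..<n}"]) auto
  have "inj_on (map_prod e e) ({..<n} \<times> {..<n})" using enum_inj by (rule map_prod_inj_on[OF _ enum_inj])
  then have inj: "inj_on (map_prod e e) ?S" by (rule inj_on_subset) auto
  have "2 * (x \<bullet> normal (seg e D)) = (\<Sum>z\<in>?S. x $ e (fst z) - x $ e (snd z))"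
    unfolding inner_normal sep_seg[OF D] sum.reindex[OF inj]
    by (simp add: case_prod_unfold)
  also have "\<dots> = (\<Sum>z\<in>?S. \<Sum>c\<in>{1..<n}. if fst z < c \<and> c \<le> snd z then \<kappa> c else 0)"
  proof (rule sum.cong[OF refl])
    fix z assume "z \<in> ?S"
    then have z: "fst z \<le> snd z" "snd z < n" by auto
    have "x $ e (fst z) - x $ e (snd z) = (\<Sum>c\<in>{fst z<..snd z}. \<kappa> c)"
      using diff_eq_sum_gaps[OF z(1), of "\<lambda>i. x $ e i"] by (simp add: \<kappa>_def)
    also have "\<dots> = (\<Sum>c\<in>{c \<in> {1..<n}. fst z < c \<and> c \<le> snd z}. \<kappa> c)"
      using z(2) by (intro sum.cong) auto
    also have "\<dots> = (\<Sum>c\<in>{1..<n}. if fst z < c \<and> c \<le> snd z then \<kappa> c else 0)"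
      by (rule sum.inter_filter) simp
    finally show "x $ e (fst z) - x $ e (snd z) = (\<Sum>c\<in>{1..<n}. if fst z < c \<and> c \<le> snd z then \<kappa> c else 0)" .
  qed
  also have "\<dots> = (\<Sum>c\<in>{1..<n}. \<Sum>z\<in>?S. if fst z < c \<and> c \<le> snd z then \<kappa> c else 0)"
    by (rule sum.swap)
  also have "\<dots> = (\<Sum>c\<in>{1..<n}. \<kappa> c * (real (card (unsep n {} c)) - real (card (unsep n D c))))"
  proof (rule sum.cong[OF refl])
    fix c
    have "{z \<in> ?S. fst z < c \<and> c \<le> snd z} = unsep n {} c - unsep n D c"
      by (auto simp: unsep_def)
    moreover have "card (unsep n {} c - unsep n D c) = card (unsep n {} c) - card (unsep n D c)"
      by (intro card_Diff_subset unsep_antimono) auto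
    moreover have "card (unsep n D c) \<le> card (unsep n {} c)" by (intro card_mono unsep_antimono) auto
    ultimately show "(\<Sum>z\<in>?S. if fst z < c \<and> c \<le> snd z then \<kappa> c else 0) =
        \<kappa> c * (real (card (unsep n {} c)) - real (card (unsep n D c)))"
      using finS by (simp add: of_nat_diff flip: sum.inter_filter)
  qed
  also have "\<dots> = gap_sum n {} \<kappa> - gap_sum n D \<kappa>"
    by (simp add: gap_sum_def right_diff_distrib sum_subtractf)
  finally show ?thesis by simp
qed

end

section \<open>The face lattice\<close>

definition chain_bound :: "'n::finite itself \<Rightarrow> (nat \<Rightarrow> real) \<Rightarrow> 'n set set \<Rightarrow> real" where
  "chain_bound _ \<eta> C = \<eta> (CARD('n) - 1) - \<eta> (CARD('n) - 1 - card C)"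

definition chain_polytope :: "(nat \<Rightarrow> real) \<Rightarrow> (real ^ 'n::{finite,linorder}) set" where
  "chain_polytope \<eta> = {x \<in> A_space. \<forall>C\<in>set_chains. x \<bullet> normal C \<le> chain_bound TYPE('n) \<eta> C}"

definition flags :: "'a set set set set" where
  "flags = {f. f \<subseteq> set_chains \<and> (\<forall>C\<in>f. \<forall>D\<in>f. C \<subseteq> D \<or> D \<subseteq> C)}"

definition gaps :: "(nat \<Rightarrow> 'n) \<Rightarrow> real ^ 'n \<Rightarrow> nat \<Rightarrow> real" where
  "gaps e x c = x $ e (c - 1) - x $ e c"

context growth
begin

context
  fixes tn :: "'n::{finite,linorder} itself"
  assumes n: "n = CARD('n)"
begin

lemma inner_normal_le_iff:
  fixes e :: "nat \<Rightarrow> 'n" and x :: "(real, 'n) vec"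
  assumes e: "bij_betw e {..<n} UNIV" and D: "D \<subseteq> {1..<n}"
  shows "x \<bullet> normal (seg e D) \<le> chain_bound TYPE('n) \<eta> (seg e D) \<longleftrightarrow>
      gap_sum n {} (gaps e x) - gap_sum n D (gaps e x) \<le> 2 * (\<eta> (n - 1) - \<eta> (n - 1 - card D))"
    and "x \<bullet> normal (seg e D) = chain_bound TYPE('n) \<eta> (seg e D) \<longleftrightarrow> tight (gaps e x) D"
  using inner_normal_seg[OF n e D, of x] card_seg[OF n e D]
  by (auto simp: chain_bound_def tight_def gaps_def[abs_def] n[symmetric])

text \<open>A chain against the order of the coordinates could be exchanged for one with the same
  bound and a larger value, so it cannot be tight.\<close>

lemma tight_tops:
  fixes x :: "(real, 'n) vec"
  assumes x: "x \<in> chain_polytope \<eta>" and C: "C \<in> set_chains"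
    and t: "x \<bullet> normal C = chain_bound TYPE('n) \<eta> C"
  shows "tops (($) x) C"
proof (rule ccontr)
  assume nt: "\<not> ?thesis"
  obtain C' where C': "C' \<in> set_chains" "card C' = card C" "x \<bullet> normal C < x \<bullet> normal C'"
    by (rule tops_maximizer[OF C, of x]) (use nt in auto)
  then have "x \<bullet> normal C' \<le> chain_bound TYPE('n) \<eta> C'" using x by (auto simp: chain_polytope_def)
  then show False using C' t by (simp add: chain_bound_def)
qed

lemma sorted_feasible:
  fixes x :: "(real, 'n) vec"
  assumes x: "x \<in> chain_polytope \<eta>" and e: "bij_betw e {..<n} UNIV"
    and anti: "\<And>i j. i < j \<Longrightarrow> j < n \<Longrightarrow> x $ e j \<le> x $ e i"
  shows "feasible (gaps e x)"
  unfolding feasible_def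
proof (intro conjI allI impI ballI)
  fix c assume "c \<in> {1..<n}"
  then show "0 \<le> gaps e x c" using anti[of "c - 1" c] by (simp add: gaps_def)
next
  fix D assume D: "D \<subseteq> {1..<n}"
  show "gap_sum n {} (gaps e x) - gap_sum n D (gaps e x) \<le> 2 * (\<eta> (n - 1) - \<eta> (n - 1 - card D))"
  proof (cases "D = {}")
    case False
    then have "seg e D \<in> set_chains" using seg_in_set_chains[OF n e D] by simp
    then show ?thesis using x inner_normal_le_iff(1)[OF e D, of x] by (auto simp: chain_polytope_def)
  qed simp
qed

lemma tight_chain_coords:
  fixes x :: "(real, 'n) vec"
  assumes x: "x \<in> chain_polytope \<eta>" and C: "C \<in> set_chains"
    and t: "x \<bullet> normal C = chain_bound TYPE('n) \<eta> C"
  obtains e where "bij_betw e {..<n} UNIV" "\<And>i j. i < j \<Longrightarrow> j < n \<Longrightarrow> x $ e j \<le> x $ e i"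
    "\<And>A. A \<in> C \<Longrightarrow> A = e ` {..<card A}"
proof (rule chain_enumeration[of UNIV C "($) x"])
  show "x $ b \<le> x $ a" if "A \<in> C" "a \<in> A" "b \<in> UNIV - A" for A a b
    using tight_tops[OF assms] that by (auto simp: tops_def)
qed (use C n that in \<open>auto simp: set_chains_def\<close>)

text \<open>In an enumeration adapted to \<open>C\<close> and sorted by \<open>x\<close>, the index
  \<open>card A\<close> is a cut point, so its gap is positive by \<open>tight_imp_pos\<close>;
  \<open>i\<close> comes before this gap and \<open>j\<close> after it.\<close>

lemma tight_strict:
  fixes x :: "(real, 'n) vec"
  assumes x: "x \<in> chain_polytope \<eta>" and C: "C \<in> set_chains"
    and t: "x \<bullet> normal C = chain_bound TYPE('n) \<eta> C"
    and A: "A \<in> C" "i \<in> A" "j \<notin> A"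
  shows "x $ j < x $ i"
proof -
  obtain e where e: "bij_betw e {..<n} UNIV" and anti: "\<And>i j. i < j \<Longrightarrow> j < n \<Longrightarrow> x $ e j \<le> x $ e i"
    and init: "\<And>A. A \<in> C \<Longrightarrow> A = e ` {..<card A}"
    using tight_chain_coords[OF x C t] by metis
  note seg = chain_eq_seg[OF n e C init]
  have le: "x $ e l \<le> x $ e k" if "k \<le> l" "l < n" for k l
    using anti[of k l] that by (cases "k = l") auto
  have "tight (gaps e x) (card ` C)"
    using inner_normal_le_iff(2)[OF e seg(1), of x] seg(3) t by simp
  then have pos: "0 < gaps e x (card A)"
    using tight_imp_pos[OF sorted_feasible[OF x e anti] seg(1)] A(1) by blast
  have cA: "card A \<in> {1..<n}" using seg(1) A(1) by auto
  obtain k l where kl: "k < n" "l < n" "e k = i" "e l = j" using enum_ex[OF n e] by metis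
  have "k < card A" "\<not> l < card A"
    using A(2,3) init[OF A(1)] enum_mem_iff[OF n e, of _ "card A"] cA kl by (metis atLeastLessThan_iff less_imp_le)+
  then have "x $ i \<ge> x $ e (card A - 1)" "x $ e (card A) \<ge> x $ j"
    using le[of k "card A - 1"] le[of "card A" l] kl cA by auto
  then show ?thesis using pos by (simp add: gaps_def)
qed

text \<open>The enumeration is adapted to \<open>C\<close> only. By \<open>tight_strict\<close> the
  members of \<open>D\<close> are nevertheless initial segments of it, so both chains are given by
  their cut sets.\<close>

lemma tight_comparable:
  fixes x :: "(real, 'n) vec"
  assumes x: "x \<in> chain_polytope \<eta>" and C: "C \<in> set_chains" and D: "D \<in> set_chains"
    and tC: "x \<bullet> normal C = chain_bound TYPE('n) \<eta> C"
    and tD: "x \<bullet> normal D = chain_bound TYPE('n) \<eta> D"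
  shows "C \<subseteq> D \<or> D \<subseteq> C"
proof -
  obtain e where e: "bij_betw e {..<n} UNIV" and anti: "\<And>i j. i < j \<Longrightarrow> j < n \<Longrightarrow> x $ e j \<le> x $ e i"
    and initC: "\<And>A. A \<in> C \<Longrightarrow> A = e ` {..<card A}"
    using tight_chain_coords[OF x C tC] by metis
  have initD: "A = e ` {..<card A}" if "A \<in> D" for A
    by (rule initial_segment[where X = UNIV and g = "($) x"])
      (use e n anti tight_strict[OF x D tD that] in auto)
  note segC = chain_eq_seg[OF n e C initC] and segD = chain_eq_seg[OF n e D initD]
  have "tight (gaps e x) (card ` C)" "tight (gaps e x) (card ` D)"
    using inner_normal_le_iff(2)[OF e segC(1), of x] inner_normal_le_iff(2)[OF e segD(1), of x]
      segC(3) segD(3) tC tD by simp_all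
  then have "card ` C \<subseteq> card ` D \<or> card ` D \<subseteq> card ` C"
    using tight_imp_comparable[OF sorted_feasible[OF x e anti] segC(1) segD(1)] by blast
  then show ?thesis using segC(3) segD(3) unfolding seg_def by (metis image_mono)
qed

text \<open>Any two sets from the chains of a flag lie in the larger of their chains, so the union
  of the flag is again a chain and has one adapted enumeration \<open>e\<close>. The cut sets are
  nested in turn, and an enumeration adapted to them is \<open>p\<close>.\<close>

lemma flag_coords:
  fixes f :: "'n set set set"
  assumes f: "f \<in> flags"
  obtains e :: "nat \<Rightarrow> 'n" and p where "bij_betw e {..<n} UNIV" "bij_betw p {..<n - 1} {1..<n}"
    "\<And>C. C \<in> f \<Longrightarrow> \<exists>m\<in>{1..n - 1}. card ` C = p ` {..<m} \<and> C = seg e (p ` {..<m})"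
proof -
  have fC: "C \<in> set_chains" if "C \<in> f" for C using f that by (auto simp: flags_def)
  have cmp: "A \<subseteq> B \<or> B \<subseteq> A" if AB: "A \<in> \<Union>f" "B \<in> \<Union>f" for A B
  proof -
    obtain C D where CD: "C \<in> f" "D \<in> f" "A \<in> C" "B \<in> D" using AB by auto
    then have "C \<subseteq> D \<or> D \<subseteq> C" using f by (auto simp: flags_def)
    then show ?thesis using CD fC[OF CD(1)] fC[OF CD(2)] by (auto simp: set_chains_def)
  qed
  \<comment> \<open>For the constant function 0 the order condition of
    \<open>chain_enumeration\<close> holds trivially, so only nestedness matters.\<close>
  obtain e :: "nat \<Rightarrow> 'n" where "bij_betw e {..<CARD('n)} UNIV" "\<And>A. A \<in> \<Union>f \<Longrightarrow> A = e ` {..<card A}"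
    by (rule chain_enumeration[of UNIV "\<Union>f" "\<lambda>_. 0"]) (use cmp in auto)
  then have e: "bij_betw e {..<n} UNIV" and init: "\<And>C A. C \<in> f \<Longrightarrow> A \<in> C \<Longrightarrow> A = e ` {..<card A}"
    using n by auto
  have seg: "card ` C \<subseteq> {1..<n}" "card ` C \<noteq> {}" "C = seg e (card ` C)" if "C \<in> f" for C
    using chain_eq_seg[OF n e fC[OF that] init[OF that]] by blast+
  obtain p where "bij_betw p {..<card {1..<n}} {1..<n}"
    and p: "\<And>D. D \<in> (\<lambda>C. card ` C) ` f \<Longrightarrow> D = p ` {..<card D}"
  proof (rule chain_enumeration[of "{1..<n}" "(\<lambda>C. card ` C) ` f" "\<lambda>_. 0"])
    fix D D' assume "D \<in> (\<lambda>C. card ` C) ` f" "D' \<in> (\<lambda>C. card ` C) ` f"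
    then obtain C C' where "C \<in> f" "C' \<in> f" "D = card ` C" "D' = card ` C'" by auto
    moreover from this have "C \<subseteq> C' \<or> C' \<subseteq> C" using f by (auto simp: flags_def)
    ultimately show "D \<subseteq> D' \<or> D' \<subseteq> D" by auto
  next
    show "(\<lambda>C. card ` C) ` f \<subseteq> Pow {1..<n}" using seg(1) by blast
  qed auto
  then have p': "bij_betw p {..<n - 1} {1..<n}" by simp
  show ?thesis
  proof (rule that[OF e p'])
    fix C assume C: "C \<in> f"
    let ?m = "card (card ` C)"
    have "card ` C = p ` {..<?m}" using p C by blast
    moreover have "?m \<le> n - 1" using seg(1)[OF C] card_mono[of "{1..<n}" "card ` C"] by simp
    moreover have "1 \<le> ?m" using seg(2)[OF C] finite_subset[OF seg(1)[OF C]]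
      by (simp add: Suc_le_eq card_gt_0_iff)
    ultimately show "\<exists>m\<in>{1..n - 1}. card ` C = p ` {..<m} \<and> C = seg e (p ` {..<m})"
      using seg(3)[OF C] by (intro bexI[of _ ?m]) auto
  qed
qed

lemma card_perm_image:
  assumes "bij_betw p {..<n - 1} {1..<n}" "m \<le> n - 1"
  shows "card (p ` {..<m}) = m" "p ` {..<m} \<subseteq> {1..<n}"
proof -
  have "inj_on p {..<m}" using assms by (auto simp: bij_betw_def intro: inj_on_subset)
  then show "card (p ` {..<m}) = m" by (simp add: card_image)
  show "p ` {..<m} \<subseteq> {1..<n}" using assms by (auto simp: bij_betw_def)
qed

lemma flag_extends:
  fixes f :: "'n set set set"
  assumes f: "f \<in> flags"
  shows "\<exists>g\<in>flags. f \<subseteq> g \<and> card g = n - 1"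
proof -
  obtain e :: "nat \<Rightarrow> 'n" and p where e: "bij_betw e {..<n} UNIV" and p: "bij_betw p {..<n - 1} {1..<n}"
    and fep: "\<And>C. C \<in> f \<Longrightarrow> \<exists>m\<in>{1..n - 1}. card ` C = p ` {..<m} \<and> C = seg e (p ` {..<m})"
    using flag_coords[OF f] by metis
  note pm = card_perm_image[OF p]
  define g where "g = (\<lambda>m. seg e (p ` {..<m})) ` {1..n - 1}"
  have "inj_on (\<lambda>m. seg e (p ` {..<m})) {1..n - 1}"
    by (rule inj_onI) (metis atLeastAtMost_iff card_seg[OF n e] pm)
  then have "card g = n - 1" by (simp add: g_def card_image)
  moreover have "f \<subseteq> g"
  proof
    fix C assume "C \<in> f"
    then obtain m where "m \<in> {1..n - 1}" "C = seg e (p ` {..<m})" using fep by blast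
    then show "C \<in> g" unfolding g_def by blast
  qed
  moreover have "g \<in> flags"
    unfolding flags_def
  proof (intro CollectI conjI subsetI ballI)
    fix C assume "C \<in> g"
    then obtain m where "m \<in> {1..n - 1}" "C = seg e (p ` {..<m})" by (auto simp: g_def)
    then show "C \<in> set_chains" using pm(2)[of m] by (auto intro!: seg_in_set_chains[OF n e] simp: lessThan_empty_iff)
  next
    fix C D assume "C \<in> g" "D \<in> g"
    then obtain m m' where "C = seg e (p ` {..<m})" "D = seg e (p ` {..<m'})" by (auto simp: g_def)
    then show "C \<subseteq> D \<or> D \<subseteq> C"
      unfolding seg_def by (metis image_mono lessThan_subset_iff linorder_le_cases)
  qed
  ultimately show ?thesis by blast
qed

text \<open>At a point strictly decreasing along \<open>e\<close>, the chains that follow the order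
  are those of initial segments of \<open>e\<close>. Any other chain is strictly dominated by one of
  these with the same bound, so it is satisfied and not tight. This reduces the claim to the gap
  vector from \<open>flag_point\<close>.\<close>

lemma flag_realized:
  fixes f :: "'n set set set"
  assumes f: "f \<in> flags"
  shows "\<exists>x\<in>chain_polytope \<eta>. {C \<in> set_chains. x \<bullet> normal C = chain_bound TYPE('n) \<eta> C} = f"
proof -
  obtain e :: "nat \<Rightarrow> 'n" and p where e: "bij_betw e {..<n} UNIV" and p: "bij_betw p {..<n - 1} {1..<n}"
    and fep: "\<And>C. C \<in> f \<Longrightarrow> \<exists>m\<in>{1..n - 1}. card ` C = p ` {..<m} \<and> C = seg e (p ` {..<m})"
    using flag_coords[OF f] by metis
  define f' where "f' = (\<lambda>C. card ` C) ` f"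
  have "f' \<subseteq> (\<lambda>m. p ` {..<m}) ` {1..n - 1}" using fep by (fastforce simp: f'_def)
  then obtain \<kappa> where \<kappa>: "\<And>c. c \<in> {1..<n} \<Longrightarrow> 0 < \<kappa> c" "feasible \<kappa>"
    "\<And>D. D \<subseteq> {1..<n} \<Longrightarrow> D \<noteq> {} \<Longrightarrow> tight \<kappa> D \<longleftrightarrow> D \<in> f'"
    using flag_point[OF p] by metis
  \<comment> \<open>Tail sums recover coordinates from prescribed gaps; subtracting their mean moves
    the point into \<open>A_space\<close> and keeps the gaps.\<close>
  define y where "y = (\<lambda>i. \<Sum>c\<in>{i<..<n}. \<kappa> c)"
  define pos where "pos = the_inv_into {..<n} e"
  define mean where "mean = (\<Sum>v\<in>(UNIV :: 'n set). y (pos v)) / n"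
  define x :: "(real, 'n) vec" where "x = (\<chi> v. y (pos v) - mean)"
  have pos_e: "pos (e i) = i" if "i < n" for i
    using that e by (simp add: pos_def bij_betw_def the_inv_into_f_f)
  have xe: "x $ e i = y i - mean" if "i < n" for i using pos_e[OF that] by (simp add: x_def)
  have npos: "0 < n" using n by simp
  have "x \<in> A_space"
    using npos by (simp add: A_space_def x_def sum_subtractf mean_def n)
  have gap: "gaps e x c = \<kappa> c" if "c \<in> {1..<n}" for c
  proof -
    have "{c - 1<..<n} = insert c {c<..<n}" using that by auto
    then have "y (c - 1) = \<kappa> c + y c" by (simp add: y_def)
    moreover have "c - 1 < n" "c < n" using that by auto
    ultimately show ?thesis by (simp only: gaps_def xe)
  qed
  then have gs: "gap_sum n D (gaps e x) = gap_sum n D \<kappa>" for D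
    unfolding gap_sum_def by (intro sum.cong) auto
  have strict: "x $ e j < x $ e i" if ij: "i < j" "j < n" for i j
  proof -
    have "{i<..<n} = {i<..j} \<union> {j<..<n}" using ij by auto
    then have "y i = (\<Sum>c\<in>{i<..j}. \<kappa> c) + y j"
      unfolding y_def by (simp add: sum.union_disjoint ivl_disj_int)
    moreover have "0 < (\<Sum>c\<in>{i<..j}. \<kappa> c)" using ij by (intro sum_pos) (auto intro!: \<kappa>)
    ultimately show ?thesis using ij xe by simp
  qed
  have tops_seg: "C = seg e (card ` C) \<and> card ` C \<subseteq> {1..<n} \<and> card ` C \<noteq> {}"
    if C: "C \<in> set_chains" and top: "tops (($) x) C" for C
  proof -
    have "A = e ` {..<card A}" if A: "A \<in> C" for A
    proof (rule initial_segment[where X = UNIV and g = "($) x"])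
      show "bij_betw e {..<card (UNIV :: 'n set)} UNIV" using e n by simp
      show "x $ e j \<le> x $ e i" if "i < j" "j < CARD('n)" for i j using strict[of i j] that n by simp
      show "x $ b < x $ a" if ab: "a \<in> A" "b \<in> UNIV - A" for a b
      proof -
        obtain i j where ij: "i < n" "j < n" "e i = a" "e j = b" using enum_ex[OF n e] by metis
        have "i \<noteq> j" using ij ab by auto
        moreover have "x $ b \<le> x $ a" using top A ab by (auto simp: tops_def)
        ultimately show ?thesis using strict[of i j] strict[of j i] ij by (cases "i < j") auto
      qed
    qed simp
    then show ?thesis using chain_eq_seg[OF n e C] by blast
  qed
  have seg_le: "x \<bullet> normal (seg e D) \<le> chain_bound TYPE('n) \<eta> (seg e D)" if "D \<subseteq> {1..<n}" for D
    using inner_normal_le_iff(1)[OF e that] \<kappa>(2) that by (simp add: gs feasible_def)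
  have seg_tight: "x \<bullet> normal (seg e D) = chain_bound TYPE('n) \<eta> (seg e D) \<longleftrightarrow> D \<in> f'"
    if "D \<subseteq> {1..<n}" "D \<noteq> {}" for D
    using inner_normal_le_iff(2)[OF e that(1), of x] \<kappa>(3)[OF that] by (simp add: gs tight_def)
  have le: "x \<bullet> normal C \<le> chain_bound TYPE('n) \<eta> C \<and>
      (x \<bullet> normal C = chain_bound TYPE('n) \<eta> C \<longrightarrow> tops (($) x) C)" if C: "C \<in> set_chains" for C
  proof -
    obtain C' where C': "C' \<in> set_chains" "card C' = card C" "tops (($) x) C'"
      "x \<bullet> normal C \<le> x \<bullet> normal C'" "\<not> tops (($) x) C \<Longrightarrow> x \<bullet> normal C < x \<bullet> normal C'"
      using tops_maximizer[OF C, of x] by metis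
    have "x \<bullet> normal C' \<le> chain_bound TYPE('n) \<eta> C'"
      using tops_seg[OF C'(1,3)] seg_le by metis
    then have "x \<bullet> normal C' \<le> chain_bound TYPE('n) \<eta> C" using C'(2) by (simp add: chain_bound_def)
    then show ?thesis using C'(4,5) by force
  qed
  then have "x \<in> chain_polytope \<eta>" using \<open>x \<in> A_space\<close> by (auto simp: chain_polytope_def)
  moreover have "{C \<in> set_chains. x \<bullet> normal C = chain_bound TYPE('n) \<eta> C} = f"
  proof (intro equalityI subsetI)
    fix C assume C: "C \<in> {C \<in> set_chains. x \<bullet> normal C = chain_bound TYPE('n) \<eta> C}"
    then have s: "C = seg e (card ` C)" "card ` C \<subseteq> {1..<n}" "card ` C \<noteq> {}"
      using le tops_seg by blast+
    have "card ` C \<in> f'" using seg_tight[OF s(2,3)] C s(1) by auto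
    then obtain C0 where "C0 \<in> f" "card ` C = card ` C0" by (auto simp: f'_def)
    then show "C \<in> f" using fep[of C0] s(1) by metis
  next
    fix C assume C: "C \<in> f"
    then obtain m where m: "m \<in> {1..n - 1}" "card ` C = p ` {..<m}" "C = seg e (p ` {..<m})" using fep by blast
    have pm: "p ` {..<m} \<subseteq> {1..<n}" "p ` {..<m} \<noteq> {}" using card_perm_image[OF p, of m] m(1) by auto
    have "p ` {..<m} \<in> f'" unfolding f'_def m(2)[symmetric] using C by (rule imageI)
    then have "x \<bullet> normal C = chain_bound TYPE('n) \<eta> C" using seg_tight[OF pm] m(3) by simp
    moreover have "C \<in> set_chains" using f C by (auto simp: flags_def)
    ultimately show "C \<in> {C \<in> set_chains. x \<bullet> normal C = chain_bound TYPE('n) \<eta> C}" by simp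
  qed
  ultimately show ?thesis by blast
qed

end

end

section \<open>Dimension of the space and number of faces\<close>

lemma A_space_hyperplane: "A_space = {x :: real ^ 'n::{finite,linorder}. (\<chi> i. 1) \<bullet> x = 0}"
  by (auto simp: A_space_def inner_vec_def)

lemma dim_A_space: "dim (A_space :: (real ^ 'n::{finite,linorder}) set) = CARD('n) - 1"
  unfolding A_space_hyperplane by (subst dim_hyperplane) (auto simp: vec_eq_iff)

text \<open>Below its largest chain \<open>C\<close> a flag consists of nonempty proper subsets of
  \<open>C\<close>, so \<open>chains_in C k\<close> is applied with \<open>C\<close> itself as the
  ground set.\<close>

lemma card_flags_set_chains:
  "card {f \<in> (flags :: 'n::finite set set set set). card f = Suc k} =
     (\<Sum>m\<in>{1..<CARD('n)}. chain_count CARD('n) m * chain_count m k)"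
proof -
  let ?n = "CARD('n)"
  let ?S = "set_chains :: 'n set set set"
  have eq: "{f \<in> (flags :: 'n::finite set set set set). card f = Suc k} =
      {f. f \<subseteq> ?S \<and> (\<forall>A\<in>f. \<forall>B\<in>f. A \<subseteq> B \<or> B \<subseteq> A) \<and> card f = Suc k}" by (auto simp: flags_def)
  have down: "C \<in> ?S" if "D \<in> ?S" "C \<subseteq> D" "C \<noteq> {}" for C D
    using that by (simp add: set_chains_def) (meson subsetD)
  have "card {f \<in> (flags :: 'n::finite set set set set). card f = Suc k} = (\<Sum>C\<in>?S. card (chains_in C k))"
    unfolding eq
  proof (rule card_flags_Suc)
    show "{} \<notin> ?S" by (simp add: set_chains_def)
  qed (use down in simp_all)
  also have "\<dots> = (\<Sum>C\<in>?S. chain_count (card C) k)" by (simp add: card_chains_in)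
  also have "\<dots> = (\<Sum>m\<in>{1..<?n}. \<Sum>C\<in>{C \<in> ?S. card C = m}. chain_count (card C) k)"
  proof (rule sum.group[symmetric])
    show "card ` ?S \<subseteq> {1..<?n}"
    proof (rule image_subsetI)
      fix C :: "'n set set" assume C: "C \<in> ?S"
      then have "C \<noteq> {}" by (simp add: set_chains_def)
      obtain e :: "nat \<Rightarrow> 'n" where e: "bij_betw e {..<?n} UNIV" "\<And>A. A \<in> C \<Longrightarrow> A = e ` {..<card A}"
        by (rule chain_enumeration[of UNIV C "\<lambda>_. 0"]) (use C in \<open>auto simp: set_chains_def\<close>)
      note s = chain_eq_seg[OF refl e(1) C e(2)]
      have "card C \<le> card {1..<?n}" using card_seg[OF refl e(1) s(1)] s(1,3) card_mono[OF _ s(1)] by simp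
      moreover have "0 < card C" "0 < ?n" using \<open>C \<noteq> {}\<close> by (simp_all add: card_gt_0_iff)
      ultimately show "card C \<in> {1..<?n}" by simp
    qed
  qed auto
  also have "\<dots> = (\<Sum>m\<in>{1..<?n}. chain_count ?n m * chain_count m k)"
  proof (rule sum.cong[OF refl])
    fix m assume m: "m \<in> {1..<?n}"
    have "{C \<in> ?S. card C = m} = chains_in UNIV m" using m by (auto simp: set_chains_def chains_in_def)
    then have "card {C \<in> ?S. card C = m} = chain_count ?n m" by (simp add: card_chains_in)
    moreover have "(\<Sum>C\<in>{C \<in> ?S. card C = m}. chain_count (card C) k) = (\<Sum>C\<in>{C \<in> ?S. card C = m}. chain_count m k)"
      by (intro sum.cong) auto
    ultimately show "(\<Sum>C\<in>{C \<in> ?S. card C = m}. chain_count (card C) k) = chain_count ?n m * chain_count m k"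
      by simp
  qed
  finally show ?thesis .
qed

lemma card_faces_chain_polytope:
  fixes \<eta> :: "nat \<Rightarrow> real"
  assumes g: "growth CARD('n::{finite,linorder}) \<eta>" and k: "k + 1 \<le> CARD('n) - 1"
  shows "card (faces_of_codim (chain_polytope \<eta> :: (real, 'n) vec set) (k + 1)) =
    (\<Sum>m\<in>{1..<CARD('n)}. chain_count CARD('n) m * chain_count m k)"
proof -
  interpret growth "CARD('n)" \<eta> by (rule g)
  have aff: "affine (A_space :: (real, 'n) vec set)" unfolding A_space_hyperplane by (rule affine_hyperplane)
  have "subspace (A_space :: (real, 'n) vec set)" unfolding A_space_hyperplane by (rule subspace_hyperplane)
  then have dim: "aff_dim (A_space :: (real, 'n) vec set) \<le> int (CARD('n) - 1)"
    by (simp add: aff_dim_subspace dim_A_space)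
  have "card (faces_of_codim (chain_polytope \<eta> :: (real, 'n) vec set) (k + 1)) = card {f \<in> (flags :: 'n set set set set). card f = k + 1}"
  proof (rule card_faces_of_codim[OF aff dim _ chain_polytope_def])
    show "{C \<in> set_chains. x \<bullet> normal C = chain_bound TYPE('n) \<eta> C} \<in> flags"
      if "x \<in> chain_polytope \<eta>" for x :: "(real, 'n) vec"
      using tight_comparable[OF refl that] by (auto simp: flags_def)
    show "\<exists>x\<in>chain_polytope \<eta>. {C \<in> set_chains. x \<bullet> normal C = chain_bound TYPE('n) \<eta> C} = f"
      if "f \<in> flags" for f :: "'n set set set"
      using flag_realized[OF refl that] .
    show "\<exists>g\<in>flags. f \<subseteq> g \<and> card g = CARD('n) - 1" if "f \<in> flags" for f :: "'n set set set"
      using flag_extends[OF refl that] .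
    show "g' \<in> flags" if "f \<in> flags" "g' \<subseteq> f" for f g' :: "'n set set set"
      using that unfolding flags_def by (simp add: subset_iff)
    show "finite (set_chains :: 'n set set set)" "{} \<in> (flags :: 'n set set set set)"
      by (auto simp: flags_def)
    show "k + 1 \<le> CARD('n) - 1" by (rule k)
  qed
  then show ?thesis using card_flags_set_chains[of k, where 'n = 'n] by simp
qed

section \<open>The permutonestohedron of type A\<close>

lemma monotone_enumeration:
  obtains e :: "nat \<Rightarrow> 'n::{finite,linorder}" where "bij_betw e {..<CARD('n)} UNIV"
    "\<And>i j. i < j \<Longrightarrow> j < CARD('n) \<Longrightarrow> e i < e j"
proof
  let ?xs = "sorted_list_of_set (UNIV :: 'n set)"
  show "bij_betw ((!) ?xs) {..<CARD('n)} UNIV" by (intro bij_betw_nth) auto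
  show "?xs ! i < ?xs ! j" if "i < j" "j < CARD('n)" for i j
    using sorted_wrt_nth_less[OF strict_sorted_list_of_set[of "UNIV :: 'n set"]] that by simp
qed

context
  fixes e :: "nat \<Rightarrow> 'n::{finite,linorder}" and n :: nat
  assumes n: "n = CARD('n)" and e: "bij_betw e {..<n} UNIV"
    and mono: "\<And>i j. i < j \<Longrightarrow> j < n \<Longrightarrow> e i < e j"
begin

section \<open>Simple roots, their spans and half sums of positive roots\<close>

definition root :: "nat \<Rightarrow> nat \<Rightarrow> (real, 'n) vec" where
  "root i j = axis (e i) 1 - axis (e j) 1"

definition simple :: "nat \<Rightarrow> (real, 'n) vec" where
  "simple c = root (c - 1) c"

text \<open>On \<open>A_space\<close> this is the pairing with the \<open>d\<close>-th fundamental
  coweight: it reads off the coefficient of \<open>simple d\<close>.\<close>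

definition partial_sum :: "nat \<Rightarrow> (real, 'n) vec \<Rightarrow> real" where
  "partial_sum d x = (\<Sum>t<d. x $ e t)"

lemma less_iff: "i < n \<Longrightarrow> j < n \<Longrightarrow> e i < e j \<longleftrightarrow> i < j"
  using mono[of i j] mono[of j i] by (metis less_asym less_irrefl linorder_neqE_nat)

lemma eq_iff: "i < n \<Longrightarrow> j < n \<Longrightarrow> e i = e j \<longleftrightarrow> i = j"
  using mono[of i j] mono[of j i] by (metis less_irrefl linorder_neqE_nat)

lemma linear_partial_sum: "linear (partial_sum d)"
  by (rule linearI) (simp_all add: partial_sum_def sum.distrib sum_distrib_left)

lemma partial_sum_root:
  assumes "i < j" "j < n" "d \<le> n"
  shows "partial_sum d (root i j) = (if i < d \<and> d \<le> j then 1 else 0)"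
proof -
  have "partial_sum d (root i j) = (\<Sum>t<d. (if t = i then 1 else 0) - (if t = j then 1 else 0))"
    unfolding partial_sum_def root_def using assms
    by (intro sum.cong) (auto simp: axis_def eq_iff)
  then show ?thesis using assms by (simp add: sum_subtractf)
qed

lemma partial_sum_simple:
  "c \<in> {1..<n} \<Longrightarrow> d \<in> {1..<n} \<Longrightarrow> partial_sum d (simple c) = (if d = c then 1 else 0)"
  by (auto simp: simple_def partial_sum_root)

lemma inj_root: "inj_on (\<lambda>(i, j). root i j) {(i, j). i < j \<and> j < n}"
proof (rule inj_onI)
  fix z z' assume z: "z \<in> {(i, j). i < j \<and> j < n}" "z' \<in> {(i, j). i < j \<and> j < n}"
    and eq: "(\<lambda>(i, j). root i j) z = (\<lambda>(i, j). root i j) z'"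
  obtain i j i' j' where zz: "z = (i, j)" "z' = (i', j')" by force
  have "root i j $ e i = root i' j' $ e i" "root i j $ e j = root i' j' $ e j" using eq zz by auto
  then show "z = z'" using z zz by (auto simp: root_def axis_def eq_iff split: if_splits)
qed

lemma simple_roots_eq: "A_simple_roots = simple ` {1..<n}"
proof (intro equalityI subsetI)
  fix v :: "(real, 'n) vec" assume "v \<in> A_simple_roots"
  then obtain a b where v: "v = axis a 1 - axis b 1" "a < b" "\<not> (\<exists>k. a < k \<and> k < b)"
    by (auto simp: A_simple_roots_def)
  obtain i j where ij: "i < n" "j < n" "e i = a" "e j = b" using enum_ex[OF n e] by metis
  then have "i < j" using v(2) less_iff by auto
  have "\<not> i + 1 < j" using v(3) mono[of i "i + 1"] mono[of "i + 1" j] ij by auto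
  then have "j = i + 1" using \<open>i < j\<close> by simp
  then show "v \<in> simple ` {1..<n}" using ij v(1) by (intro image_eqI[of _ _ j]) (auto simp: simple_def root_def)
next
  fix v assume "v \<in> simple ` {1..<n}"
  then obtain c where c: "c \<in> {1..<n}" "v = simple c" by auto
  have "\<not> (\<exists>k. e (c - 1) < k \<and> k < e c)"
  proof
    assume "\<exists>k. e (c - 1) < k \<and> k < e c"
    then obtain t where "t < n" "e (c - 1) < e t" "e t < e c" using enum_ex[OF n e] by metis
    moreover have "c - 1 < n" "c < n" using c(1) by auto
    ultimately have "c - 1 < t" "t < c" using less_iff by blast+
    then show False by linarith
  qed
  moreover have "e (c - 1) < e c" using c by (intro mono) auto
  ultimately show "v \<in> A_simple_roots" using c(2) by (auto simp: A_simple_roots_def simple_def root_def)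
qed

lemma pos_roots_eq: "A_pos_roots = (\<lambda>(i, j). root i j) ` {(i, j). i < j \<and> j < n}"
proof (intro equalityI subsetI)
  fix v :: "(real, 'n) vec" assume "v \<in> A_pos_roots"
  then obtain a b where v: "v = axis a 1 - axis b 1" "a < b" by (auto simp: A_pos_roots_def)
  obtain i j where ij: "i < n" "j < n" "e i = a" "e j = b" using enum_ex[OF n e] by metis
  then show "v \<in> (\<lambda>(i, j). root i j) ` {(i, j). i < j \<and> j < n}"
    using v less_iff by (intro image_eqI[of _ _ "(i, j)"]) (auto simp: root_def)
qed (auto simp: A_pos_roots_def root_def intro: mono)

lemma span_simple_vanish:
  assumes S: "S \<subseteq> {1..<n}" and d: "d \<in> {1..<n}" "d \<notin> S" and x: "x \<in> span (simple ` S)"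
  shows "partial_sum d x = 0"
proof -
  have "partial_sum d y = 0" if "y \<in> simple ` S" for y
    using that S d by (auto simp: partial_sum_simple subset_iff)
  then show ?thesis using linear_eq_0_on_span[OF linear_partial_sum] x by blast
qed

text \<open>\<open>root i j\<close> is the sum of \<open>simple c\<close> over i < c \<le> j, and
  \<open>partial_sum d\<close> detects any summand missing from \<open>S\<close>.\<close>

lemma root_in_span_iff:
  assumes S: "S \<subseteq> {1..<n}" and ij: "i < j" "j < n"
  shows "root i j \<in> span (simple ` S) \<longleftrightarrow> {i<..j} \<subseteq> S"
proof
  assume r: "root i j \<in> span (simple ` S)"
  show "{i<..j} \<subseteq> S"
  proof (rule subsetI, rule ccontr)
    fix d assume d: "d \<in> {i<..j}" "d \<notin> S"
    then have "partial_sum d (root i j) = 0" using span_simple_vanish[OF S _ _ r] ij by auto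
    then show False using partial_sum_root[OF ij, of d] d ij by auto
  qed
next
  assume sub: "{i<..j} \<subseteq> S"
  have "root i j = (\<Sum>c\<in>{i<..j}. simple c)"
  proof -
    have "root i k = (\<Sum>c\<in>{i<..k}. simple c)" if "i \<le> k" for k
      using that
    proof (induction k)
      case (Suc k)
      show ?case
      proof (cases "i = Suc k")
        case False
        then have "{i<..Suc k} = insert (Suc k) {i<..k}" using Suc.prems by auto
        moreover have "root i (Suc k) = simple (Suc k) + root i k" by (simp add: simple_def root_def)
        ultimately show ?thesis using Suc False by simp
      qed (simp add: root_def)
    qed (simp add: root_def)
    then show ?thesis using ij by simp
  qed
  also have "\<dots> \<in> span (simple ` S)" using sub by (intro span_sum span_base) auto
  finally show "root i j \<in> span (simple ` S)" .
qed

lemma inj_simple: "inj_on simple {1..<n}"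
  by (rule inj_onI) (metis partial_sum_simple zero_neq_one)

lemma independent_simple: "S \<subseteq> {1..<n} \<Longrightarrow> independent (simple ` S)"
proof
  assume S: "S \<subseteq> {1..<n}" and "dependent (simple ` S)"
  then obtain c where c: "c \<in> S" "simple c \<in> span (simple ` S - {simple c})" by (auto simp: dependent_def)
  have "x = c" if "x \<in> S" "simple x = simple c" for x
    by (rule inj_onD[OF inj_simple that(2)]) (use S c that in auto)
  then have "simple ` S - {simple c} = simple ` (S - {c})" by auto
  then have "partial_sum c (simple c) = 0"
    using c S by (intro span_simple_vanish[of "S - {c}"]) auto
  then show False using partial_sum_simple[of c c] c S by auto
qed

lemma dim_span_simple: "S \<subseteq> {1..<n} \<Longrightarrow> dim (span (simple ` S)) = card S"
  using dim_span_eq_card_independent[OF independent_simple] card_image[OF inj_on_subset[OF inj_simple]] by metis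

lemma A_space_eq: "A_space = span (simple ` {1..<n})"
proof (rule sym, rule subspace_dim_equal)
  show sub: "subspace (A_space :: (real, 'n) vec set)" unfolding A_space_hyperplane by (rule subspace_hyperplane)
  have "simple c \<in> A_space" for c
    by (simp add: simple_def root_def A_space_def axis_def sum_subtractf)
  then show "span (simple ` {1..<n}) \<subseteq> A_space" using sub by (intro span_minimal) auto
  show "dim (A_space :: (real, 'n) vec set) \<le> dim (span (simple ` {1..<n}))"
    using dim_A_space[where 'n = 'n] dim_span_simple[of "{1..<n}"] n by simp
qed simp

lemma span_simple_inj:
  assumes "S \<subseteq> {1..<n}" "T \<subseteq> {1..<n}" "span (simple ` S) \<subseteq> span (simple ` T)"
  shows "S \<subseteq> T"
proof
  fix c assume c: "c \<in> S"
  then have "root (c - 1) c \<in> span (simple ` T)"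
    using assms(3) span_base[of "simple c" "simple ` S"] by (auto simp: simple_def)
  moreover have "c - 1 < c" "c < n" using c assms(1) by auto
  ultimately have "{c - 1<..c} \<subseteq> T" using root_in_span_iff[OF assms(2)] by blast
  then show "c \<in> T" using \<open>c - 1 < c\<close> by auto
qed

lemma pi_sum_span:
  assumes S: "S \<subseteq> {1..<n}"
  shows "A_pi_sum (span (simple ` S)) =
    (1/2) *\<^sub>R (\<Sum>(i, j)\<in>{(i, j). i < j \<and> j < n \<and> {i<..j} \<subseteq> S}. root i j)"
proof -
  have "A_pos_roots \<inter> span (simple ` S) = (\<lambda>(i, j). root i j) ` {(i, j). i < j \<and> j < n \<and> {i<..j} \<subseteq> S}"
    unfolding pos_roots_eq using root_in_span_iff[OF S] by auto
  moreover have "inj_on (\<lambda>(i, j). root i j) {(i, j). i < j \<and> j < n \<and> {i<..j} \<subseteq> S}"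
    by (rule inj_on_subset[OF inj_root]) auto
  ultimately show ?thesis by (simp add: type_A.pi_sum_def sum.reindex case_prod_unfold)
qed

text \<open>The positive roots outside the span of \<open>S\<close> are the pairs separated by an
  index not in \<open>S\<close>, so the indices not in \<open>S\<close> become the cut
  points.\<close>

lemma delta_diff:
  assumes S: "S \<subseteq> {1..<n}"
  shows "A_pi_sum (span (simple ` {1..<n})) - A_pi_sum (span (simple ` S)) = normal (seg e ({1..<n} - S))"
proof -
  let ?PS = "\<lambda>S. {(i, j). i < j \<and> j < n \<and> {i<..j} \<subseteq> S}"
  let ?S = "{(i, j). i < n \<and> j < n \<and> (\<exists>d\<in>{1..<n} - S. i < d \<and> d \<le> j)}"
  have fin: "finite (?PS {1..<n})" by (rule finite_subset[of _ "{..<n} \<times> {..<n}"]) auto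
  have diff: "?PS {1..<n} - ?PS S = ?S" by (auto simp: subset_iff)
  have sub: "?PS S \<subseteq> ?PS {1..<n}" using S by auto
  have "inj_on (map_prod e e) ({..<n} \<times> {..<n})" using enum_inj[OF n e] by (rule map_prod_inj_on[OF _ enum_inj[OF n e]])
  then have inj: "inj_on (map_prod e e) ?S" by (rule inj_on_subset) auto
  have "A_pi_sum (span (simple ` {1..<n})) - A_pi_sum (span (simple ` S)) =
      (1/2) *\<^sub>R ((\<Sum>(i, j)\<in>?PS {1..<n}. root i j) - (\<Sum>(i, j)\<in>?PS S. root i j))"
    unfolding pi_sum_span[OF S] pi_sum_span[OF subset_refl] by (rule scaleR_diff_right[symmetric])
  also have "(\<Sum>(i, j)\<in>?PS {1..<n}. root i j) - (\<Sum>(i, j)\<in>?PS S. root i j) = (\<Sum>(i, j)\<in>?S. root i j)"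
    unfolding diff[symmetric] by (rule sum_diff[OF fin sub, symmetric])
  also have "(1/2) *\<^sub>R (\<Sum>(i, j)\<in>?S. root i j) = normal (seg e ({1..<n} - S))"
    unfolding normal_def sep_seg[OF n e Diff_subset] sum.reindex[OF inj]
    by (simp add: case_prod_unfold root_def)
  finally show ?thesis .
qed

text \<open>\<open>partial_sum c\<close> takes the value 1 on the positive roots whose support
  contains \<open>c\<close>. Those of them in the span are the pairs around \<open>c\<close> that no
  index outside \<open>S\<close> separates.\<close>

lemma representation_pi_sum:
  assumes S: "S \<subseteq> {1..<n}" and c: "c \<in> {1..<n}"
  shows "representation A_simple_roots (A_pi_sum (span (simple ` S))) (simple c) =
    real (card (unsep n ({1..<n} - S) c)) / 2"
proof -
  let ?P = "{(i, j). i < j \<and> j < n \<and> {i<..j} \<subseteq> S}"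
  let ?v = "A_pi_sum (span (simple ` S))"
  have finP: "finite ?P" by (rule finite_subset[of _ "{..<n} \<times> {..<n}"]) auto
  have "?v \<in> span (simple ` {1..<n})"
    unfolding pi_sum_span[OF S]
    by (intro span_scale span_sum) (auto simp: root_in_span_iff)
  then have "?v = (\<Sum>b\<in>simple ` {1..<n}. representation (simple ` {1..<n}) ?v b *\<^sub>R b)"
    using independent_simple[OF subset_refl] by (intro sum_representation_eq[symmetric]) auto
  also have "\<dots> = (\<Sum>d\<in>{1..<n}. representation (simple ` {1..<n}) ?v (simple d) *\<^sub>R simple d)"
    by (subst sum.reindex[OF inj_simple]) simp
  finally have "partial_sum c ?v = partial_sum c (\<Sum>d\<in>{1..<n}. representation (simple ` {1..<n}) ?v (simple d) *\<^sub>R simple d)"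
    by (rule arg_cong)
  also have "\<dots> = (\<Sum>d\<in>{1..<n}. representation (simple ` {1..<n}) ?v (simple d) * partial_sum c (simple d))"
    by (simp add: linear_sum[OF linear_partial_sum] linear_scale[OF linear_partial_sum])
  also have "\<dots> = (\<Sum>d\<in>{1..<n}. if c = d then representation (simple ` {1..<n}) ?v (simple d) else 0)"
    using c by (intro sum.cong) (auto simp: partial_sum_simple)
  also have "\<dots> = representation (simple ` {1..<n}) ?v (simple c)" using c by simp
  finally have "representation A_simple_roots ?v (simple c) = partial_sum c ?v" by (simp add: simple_roots_eq)
  also have "\<dots> = (1/2) * (\<Sum>z\<in>?P. partial_sum c (root (fst z) (snd z)))"
    unfolding pi_sum_span[OF S]
    by (simp add: linear_sum[OF linear_partial_sum] linear_scale[OF linear_partial_sum] case_prod_unfold)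
  also have "(\<Sum>z\<in>?P. partial_sum c (root (fst z) (snd z))) = (\<Sum>z\<in>?P. if fst z < c \<and> c \<le> snd z then 1 else 0)"
    using c by (intro sum.cong) (auto simp: partial_sum_root)
  also have "\<dots> = real (card {z \<in> ?P. fst z < c \<and> c \<le> snd z})"
    using finP by (simp flip: sum.inter_filter)
  also have "{z \<in> ?P. fst z < c \<and> c \<le> snd z} = unsep n ({1..<n} - S) c"
    by (auto simp: unsep_def subset_iff)
  finally show ?thesis by simp
qed

section \<open>Half-spaces of the maximal building set\<close>

lemma G_fund_eq: "A_G_fund A_max_building_set = {span (simple ` S) |S. S \<subseteq> {1..<n} \<and> S \<noteq> {}}"
proof (intro equalityI subsetI)
  fix A :: "(real, 'n) vec set" assume "A \<in> A_G_fund A_max_building_set"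
  then obtain R S where R: "R \<subseteq> A_roots" "R \<noteq> {}" "A = span R" and "S \<subseteq> A_simple_roots" "A = span S"
    by (auto simp: type_A.G_fund_def type_A.max_building_set_def)
  then obtain T where T: "T \<subseteq> {1..<n}" "S = simple ` T" unfolding simple_roots_eq by (meson subset_imageE)
  obtain r where r: "r \<in> R" using R(2) by auto
  then obtain i j where ij: "r = axis i 1 - axis j 1" "i \<noteq> j" using R(1) by (auto simp: A_roots_def)
  have "r $ i \<noteq> 0" using ij by (simp add: axis_def)
  then have "r \<noteq> 0" by (metis zero_index)
  moreover have "r \<in> span S" using r R(3) \<open>A = span S\<close> span_base by metis
  ultimately have "T \<noteq> {}" using T(2) by auto
  then show "A \<in> {span (simple ` S) |S. S \<subseteq> {1..<n} \<and> S \<noteq> {}}" using T \<open>A = span S\<close> by auto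
next
  fix A assume "A \<in> {span (simple ` S) |S. S \<subseteq> {1..<n} \<and> S \<noteq> {}}"
  then obtain S where S: "S \<subseteq> {1..<n}" "S \<noteq> {}" "A = span (simple ` S)" by auto
  have "A_simple_roots \<subseteq> (A_roots :: (real, 'n) vec set)"
    unfolding A_simple_roots_def A_roots_def by (auto dest: less_imp_neq)
  moreover have "simple ` S \<subseteq> A_simple_roots" using S(1) by (auto simp: simple_roots_eq)
  ultimately show "A \<in> A_G_fund A_max_building_set"
    using S(2,3) unfolding type_A.G_fund_def type_A.max_building_set_def by blast
qed

text \<open>For the maximal building set this leaves no half-spaces of the form
  \<open>A_HS_bar\<close> in the intersection.\<close>

lemma C_fund_subset: "(A_C_fund :: (real, 'n) vec set set) \<subseteq> A_G_fund A_max_building_set"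
proof
  fix A :: "(real, 'n) vec set" assume "A \<in> A_C_fund"
  then obtain S where S: "S \<subseteq> simple ` {1..<n}" "S \<noteq> {}" "A = span S"
    by (auto simp: type_A.C_fund_def simple_roots_eq)
  then obtain T where "T \<subseteq> {1..<n}" "S = simple ` T" by (meson subset_imageE)
  then show "A \<in> A_G_fund A_max_building_set" using S unfolding G_fund_eq by auto
qed

lemma HS_eq:
  assumes S: "S \<subseteq> {1..<n}" "S \<noteq> {}"
    and \<eta>: "\<eta> 0 = 0" "\<eta> (n - 1) = a" "\<And>i. 1 \<le> i \<Longrightarrow> \<eta> i = \<epsilon> i"
  defines "D \<equiv> if S = {1..<n} then {1..<n} else {1..<n} - S"
  shows "A_HS \<epsilon> a (span (simple ` S)) =
    {x \<in> A_space. x \<bullet> normal (seg e D) \<le> chain_bound TYPE('n) \<eta> (seg e D)}"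
proof -
  have D: "D \<subseteq> {1..<n}" by (simp add: D_def)
  have bound: "chain_bound TYPE('n) \<eta> (seg e D) = a - \<eta> (n - 1 - card D)"
    using card_seg[OF n e D] \<eta>(2) by (simp add: chain_bound_def n)
  show ?thesis
  proof (cases "S = {1..<n}")
    case True
    have none: "{(i, j). i < j \<and> j < n \<and> {i<..j} \<subseteq> {}} = {}" by auto
    \<comment> \<open>Writing \<delta> as \<delta> minus the half sum of the zero subspace makes
      every index a cut point.\<close>
    have "A_pi_sum (span (simple ` {})) = 0" unfolding pi_sum_span[OF empty_subsetI] none by simp
    then have "A_delta = normal (seg e D)"
      using delta_diff[of "{}"] True by (simp add: type_A.\<delta>_def D_def A_space_eq)
    then show ?thesis using True bound \<eta>(1) by (simp add: type_A.HS_def A_space_eq D_def)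
  next
    case False
    then have "span (simple ` S) \<noteq> A_space"
      unfolding A_space_eq using span_simple_inj[of "{1..<n}" S] S(1) by auto
    moreover have "A_delta_sub (span (simple ` S)) = normal (seg e D)"
      using delta_diff[OF S(1)] False by (simp add: type_A.\<delta>_sub_def type_A.\<delta>_def A_space_eq D_def)
    moreover have finS: "finite S" using S(1) finite_subset by blast
    moreover have "n - 1 - card D = card S"
    proof -
      have "card D = n - 1 - card S" using False card_Diff_subset[OF finS S(1)] by (simp add: D_def)
      then show ?thesis using card_mono[OF _ S(1)] by simp
    qed
    moreover have "1 \<le> card S" using finS S(2) by (simp add: Suc_le_eq card_gt_0_iff)
    ultimately show ?thesis
      using bound \<eta>(3)[of "card S"] dim_span_simple[OF S(1)] by (simp add: type_A.HS_def)
  qed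
qed

text \<open>Complementing proper subsets and fixing the full set is an involution on the nonempty
  subsets of {1, ..., n - 1}, so every nonempty cut set occurs.\<close>

lemma HS_image_G_fund:
  assumes n2: "2 \<le> n" and \<eta>: "\<eta> 0 = 0" "\<eta> (n - 1) = a" "\<And>i. 1 \<le> i \<Longrightarrow> \<eta> i = \<epsilon> i"
  shows "A_HS \<epsilon> a ` A_G_fund A_max_building_set =
    {{x \<in> A_space. x \<bullet> normal (seg e D) \<le> chain_bound TYPE('n) \<eta> (seg e D)} |D. D \<subseteq> {1..<n} \<and> D \<noteq> {}}"
    (is "?L = ?R")
proof (intro equalityI subsetI)
  fix H assume "H \<in> ?L"
  then obtain S where S: "S \<subseteq> {1..<n}" "S \<noteq> {}" "H = A_HS \<epsilon> a (span (simple ` S))" unfolding G_fund_eq by auto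
  define D where "D = (if S = {1..<n} then {1..<n} else {1..<n} - S)"
  have "D \<subseteq> {1..<n}" "D \<noteq> {}" using S by (auto simp: D_def)
  moreover have "H = {x \<in> A_space. x \<bullet> normal (seg e D) \<le> chain_bound TYPE('n) \<eta> (seg e D)}"
    unfolding S(3) D_def by (rule HS_eq[OF S(1,2) \<eta>])
  ultimately show "H \<in> ?R" by blast
next
  fix H assume "H \<in> ?R"
  then obtain D where D: "D \<subseteq> {1..<n}" "D \<noteq> {}"
    "H = {x \<in> A_space. x \<bullet> normal (seg e D) \<le> chain_bound TYPE('n) \<eta> (seg e D)}" by blast
  define S where "S = (if D = {1..<n} then {1..<n} else {1..<n} - D)"
  have S: "S \<subseteq> {1..<n}" "S \<noteq> {}" using D n2 by (auto simp: S_def)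
  have "D = (if S = {1..<n} then {1..<n} else {1..<n} - S)" using D(1,2) by (auto simp: S_def)
  then have "H = A_HS \<epsilon> a (span (simple ` S))" using HS_eq[where \<epsilon> = \<epsilon>, OF S \<eta>] D(3) by simp
  then show "H \<in> ?L" unfolding G_fund_eq using S by blast
qed

lemma weyl_image_halfspace:
  fixes p :: "'n \<Rightarrow> 'n"
  assumes p: "bij p"
  shows "(\<lambda>x. \<chi> i. x $ inv p i) ` {x \<in> A_space. x \<bullet> normal C \<le> b} =
    {x \<in> (A_space :: (real, 'n) vec set). x \<bullet> normal ((`) p ` C) \<le> b}" (is "?f ` ?L = ?R")
proof (intro equalityI subsetI)
  have sum: "(\<Sum>i\<in>UNIV. x $ q i) = (\<Sum>i\<in>UNIV. x $ i)" if "bij q" for q and x :: "(real, 'n) vec"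
    using sum.reindex_bij_betw[OF that] .
  have inv: "inv p (p i) = i" "p (inv p i) = i" for i
    using p by (simp_all add: bij_is_inj bij_is_surj surj_f_inv_f)
  fix x :: "(real, 'n) vec"
  { assume "x \<in> ?f ` ?L"
    then show "x \<in> ?R"
      using sum[OF bij_imp_bij_inv[OF p]] by (auto simp: A_space_def inner_normal_image[OF p] inv) }
  { assume x: "x \<in> ?R"
    have "x = ?f (\<chi> i. x $ p i)" by (simp add: vec_eq_iff inv)
    moreover have "(\<chi> i. x $ p i) \<in> ?L" using x sum[OF p] by (auto simp: A_space_def inner_normal_image[OF p])
    ultimately show "x \<in> ?f ` ?L" by blast }
qed

lemma permutonestohedron_eq:
  assumes n2: "2 \<le> n" and \<eta>: "\<eta> 0 = 0" "\<eta> (n - 1) = a" "\<And>i. 1 \<le> i \<Longrightarrow> \<eta> i = \<epsilon> i"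
  shows "A_permutonestohedron A_max_building_set \<epsilon> a = (chain_polytope \<eta> :: (real, 'n) vec set)"
proof -
  let ?H = "\<lambda>C. {x \<in> (A_space :: (real, 'n) vec set). x \<bullet> normal C \<le> chain_bound TYPE('n) \<eta> C}"
  have HS: "A_HS \<epsilon> a ` A_G_fund A_max_building_set = {?H (seg e D) |D. D \<subseteq> {1..<n} \<and> D \<noteq> {}}"
    by (rule HS_image_G_fund[OF n2 \<eta>])
  have empty: "(A_C_fund :: (real, 'n) vec set set) - A_G_fund A_max_building_set = {}" using C_fund_subset by blast
  have "A_permutonestohedron A_max_building_set \<epsilon> a =
      (\<Inter>\<sigma>\<in>A_weyl. \<Inter>K\<in>A_HS \<epsilon> a ` A_G_fund A_max_building_set. \<sigma> ` (K :: (real, 'n) vec set))"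
    unfolding type_A.permutonestohedron_def empty by simp
  also have "\<dots> = \<Inter> {?H C |C. C \<in> set_chains}"
  proof (intro equalityI subsetI)
    fix x assume x: "x \<in> (\<Inter>\<sigma>\<in>A_weyl. \<Inter>K\<in>A_HS \<epsilon> a ` A_G_fund A_max_building_set. \<sigma> ` (K :: (real, 'n) vec set))"
    have "x \<in> ?H C" if C: "C \<in> set_chains" for C
    proof -
      obtain e' :: "nat \<Rightarrow> 'n" where "bij_betw e' {..<CARD('n)} UNIV" and init: "\<And>A. A \<in> C \<Longrightarrow> A = e' ` {..<card A}"
        by (rule chain_enumeration[of UNIV C "\<lambda>_. 0"]) (use C in \<open>auto simp: set_chains_def\<close>)
      then have e': "bij_betw e' {..<n} UNIV" using n by simp
      note C' = chain_eq_seg[OF n e' C init]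
      \<comment> \<open>This permutation carries the increasing enumeration \<open>e\<close> to one
        adapted to \<open>C\<close>, hence the initial-segment chain with the same cut set to
        \<open>C\<close>.\<close>
      define p where "p = e' \<circ> the_inv_into {..<n} e"
      have p: "bij p" unfolding p_def by (rule bij_betw_trans[OF bij_betw_the_inv_into[OF e] e'])
      have pe: "p (e i) = e' i" if "i < n" for i
        using that enum_inj[OF n e] by (simp add: p_def the_inv_into_f_f)
      have "p ` e ` {..<c} = e' ` {..<c}" if "c \<in> card ` C" for c
        using pe that C'(1) by (force simp: image_image intro!: image_cong)
      then have "(`) p ` seg e (card ` C) = seg e' (card ` C)" by (simp add: seg_def image_image)
      then have pC: "(`) p ` seg e (card ` C) = C" using C'(3) by simp
      have "?H (seg e (card ` C)) \<in> A_HS \<epsilon> a ` A_G_fund A_max_building_set" unfolding HS using C'(1,2) by blast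
      moreover have "(\<lambda>x. \<chi> i. x $ inv p i) \<in> (A_weyl :: ((real, 'n) vec \<Rightarrow> (real, 'n) vec) set)"
        using p by (auto simp: A_weyl_def)
      ultimately have "x \<in> (\<lambda>x. \<chi> i. x $ inv p i) ` ?H (seg e (card ` C))" using x by blast
      then show ?thesis
        unfolding weyl_image_halfspace[OF p] pC using card_image_image[OF p, of "seg e (card ` C)"] pC
        by (simp add: chain_bound_def)
    qed
    then show "x \<in> \<Inter> {?H C |C. C \<in> set_chains}" by blast
  next
    fix x assume x: "x \<in> \<Inter> {?H C |C. C \<in> set_chains}"
    show "x \<in> (\<Inter>\<sigma>\<in>A_weyl. \<Inter>K\<in>A_HS \<epsilon> a ` A_G_fund A_max_building_set. \<sigma> ` (K :: (real, 'n) vec set))"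
    proof (intro INT_I)
      fix \<sigma> and K :: "(real, 'n) vec set" assume "\<sigma> \<in> (A_weyl :: ((real, 'n) vec \<Rightarrow> (real, 'n) vec) set)" "K \<in> A_HS \<epsilon> a ` A_G_fund A_max_building_set"
      then obtain p D where p: "bij p" "\<sigma> = (\<lambda>x. \<chi> i. x $ inv p i)"
        and D: "D \<subseteq> {1..<n}" "D \<noteq> {}" "K = ?H (seg e D)"
        unfolding HS A_weyl_def by blast
      have "(`) p ` seg e D \<in> set_chains" by (rule set_chains_image[OF p(1) seg_in_set_chains[OF n e D(1,2)]])
      then have "x \<in> ?H ((`) p ` seg e D)" using x by blast
      then show "x \<in> \<sigma> ` K"
        unfolding p(2) D(3) weyl_image_halfspace[OF p(1)] using card_image_image[OF p(1), of "seg e D"]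
        by (simp add: chain_bound_def)
    qed
  qed
  also have "\<dots> = chain_polytope \<eta>"
  proof -
    \<comment> \<open>Some chain must exist, for an empty intersection would be the whole type
      instead of \<open>A_space\<close>.\<close>
    have "seg e {1..<n} \<in> set_chains" using n2 by (intro seg_in_set_chains[OF n e]) auto
    then show ?thesis by (auto simp: chain_polytope_def)
  qed
  finally show ?thesis .
qed

text \<open>One explicit pair suffices. The simple roots 1, ..., i span \<open>A\<close>, and the
  coefficient of its half sum at the m-th one is m (i + 1 - m) / 2, largest in the middle. Dropping
  the second simple root isolates the first one in \<open>B\<close>, where its coefficient is
  1/2.\<close>

lemma R_dim_ge:
  assumes i: "2 \<le> i" "i < n"
  shows "real ((i + 1)\<^sup>2 div 4) \<le> A_R_dim (A_max_building_set :: (real, 'n) vec set set) i (i - 1)"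
proof -
  let ?G = "A_G_fund A_max_building_set :: (real, 'n) vec set set"
  let ?rep = "\<lambda>A. representation A_simple_roots (A_pi_sum A)"
  define A where "A = span (simple ` {1..i})"
  define B where "B = span (simple ` ({1..i} - {2}))"
  have sub: "{1..i} \<subseteq> {1..<n}" "{1..i} - {2} \<subseteq> {1..<n}" using i by auto
  have "A_R_pair A B \<in> {A_R_pair A B |A B. A \<in> ?G \<and> B \<in> ?G \<and> B \<subset> A \<and> dim A = i \<and> dim B = i - 1}"
  proof -
    have "1 \<in> {1..i}" "1 \<in> {1..i} - {2}" using i by auto
    then have "A \<in> ?G" "B \<in> ?G" unfolding G_fund_eq A_def B_def using sub by blast+
    moreover have "B \<subseteq> A" unfolding A_def B_def by (intro span_mono image_mono) auto
    moreover have "2 \<in> {1..i}" "2 \<notin> {1..i} - {2}" using i by auto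
    then have "\<not> A \<subseteq> B" unfolding A_def B_def using span_simple_inj[OF sub] by blast
    moreover have "dim A = i" "dim B = i - 1"
      using dim_span_simple[OF sub(1)] dim_span_simple[OF sub(2)] i by (auto simp: A_def B_def)
    ultimately show ?thesis by blast
  qed
  moreover have "finite {A_R_pair A B |A B. A \<in> ?G \<and> B \<in> ?G \<and> B \<subset> A \<and> dim A = i \<and> dim B = i - 1}"
  proof (rule finite_subset)
    have "?G = (\<lambda>S. span (simple ` S)) ` (Pow {1..<n} - {{}})" unfolding G_fund_eq by auto
    then show "finite ((\<lambda>(A, B). A_R_pair A B) ` (?G \<times> ?G))" by simp
  qed auto
  ultimately have le: "A_R_pair A B \<le> A_R_dim (A_max_building_set :: (real, 'n) vec set set) i (i - 1)"
    unfolding type_A.R_dim_def by (intro Max_ge)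
  have finS: "finite (A_simple_roots :: (real, 'n) vec set)" by (simp add: simple_roots_eq)
  define m where "m = (i + 1) div 2"
  have m: "m \<in> {1..i}" using i by (auto simp: m_def)
  have "(i + 1)\<^sup>2 div 4 \<le> m * (i + 1 - m)"
  proof (cases "even (i + 1)")
    case True
    then obtain q where "i + 1 = 2 * q" by blast
    then show ?thesis by (simp add: m_def power2_eq_square)
  next
    case False
    then obtain q where q: "i + 1 = 2 * q + 1" by (metis oddE)
    have "(2 * q + 1)\<^sup>2 = 4 * (q * (q + 1)) + 1" by (simp add: power2_eq_square algebra_simps)
    then have "(2 * q + 1)\<^sup>2 div 4 = q * (q + 1)" by presburger
    moreover have "m = q" "i + 1 - m = q + 1" using q by (simp_all add: m_def)
    ultimately show ?thesis using q by simp
  qed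
  also have "m * (i + 1 - m) = card ({..<m} \<times> {m..i})" by simp
  also have "\<dots> \<le> card (unsep n ({1..<n} - {1..i}) m)"
    using i m by (intro card_mono finite_unsep) (auto simp: unsep_def)
  finally have "real ((i + 1)\<^sup>2 div 4) / 2 \<le> ?rep A (simple m)"
    using representation_pi_sum[OF sub(1), of m] m i by (simp add: A_def)
  also have "\<dots> \<le> Max (?rep A ` A_simple_roots)"
    using finS m i by (intro Max_ge) (auto simp: simple_roots_eq)
  finally have maxA: "real ((i + 1)\<^sup>2 div 4) / 2 \<le> Max (?rep A ` A_simple_roots)" .
  have inB: "simple c \<in> B \<longleftrightarrow> c \<in> {1..i} - {2}" if c: "c \<in> {1..<n}" for c
  proof
    assume "simple c \<in> B"
    then have "span (simple ` {c}) \<subseteq> B" unfolding B_def by (intro span_minimal) auto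
    then have "{c} \<subseteq> {1..i} - {2}"
      using span_simple_inj[of "{c}" "{1..i} - {2}"] c sub(2) by (simp add: B_def)
    then show "c \<in> {1..i} - {2}" by simp
  qed (auto simp: B_def intro: span_base)
  let ?M = "?rep B ` (A_simple_roots \<inter> B)"
  have one: "1 \<in> {1..<n}" "simple 1 \<in> A_simple_roots \<inter> B" using inB[of 1] i by (auto simp: simple_roots_eq)
  have finM: "finite ?M" "?M \<noteq> {}" using finS one by auto
  have "unsep n ({1..<n} - ({1..i} - {2})) 1 \<subseteq> {(0, 1)}"
  proof
    fix z assume z: "z \<in> unsep n ({1..<n} - ({1..i} - {2})) 1"
    have "2 \<in> {1..<n} - ({1..i} - {2})" using i by auto
    then have "\<not> (fst z < 2 \<and> 2 \<le> snd z)" using z by (auto simp: unsep_def)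
    then show "z \<in> {(0, 1)}" using z by (auto simp: unsep_def)
  qed
  then have "card (unsep n ({1..<n} - ({1..i} - {2})) 1) \<le> 1" using card_mono[of "{(0::nat, 1::nat)}"] by simp
  then have "?rep B (simple 1) \<le> 1/2"
    using representation_pi_sum[OF sub(2) one(1)] by (simp add: B_def)
  moreover have "Min ?M \<le> ?rep B (simple 1)" using finM one by (intro Min_le) auto
  ultimately have minB: "Min ?M \<le> 1/2" by simp
  \<comment> \<open>Coefficients of \<open>B\<close> at its own simple roots are at least 1/2, so
    dividing by their minimum preserves the inequality.\<close>
  have "0 < Min ?M"
  proof -
    have "0 < ?rep B b" if "b \<in> A_simple_roots \<inter> B" for b
    proof -
      obtain c where c: "c \<in> {1..<n}" "b = simple c" "c \<in> {1..i} - {2}"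
        using \<open>b \<in> A_simple_roots \<inter> B\<close> inB by (auto simp: simple_roots_eq)
      then have "1 \<le> card (unsep n ({1..<n} - ({1..i} - {2})) c)" by (intro card_unsep_pos) auto
      then show ?thesis using representation_pi_sum[OF sub(2) c(1)] c(2) by (simp add: B_def)
    qed
    then show ?thesis using finM by (subst Min_gr_iff) auto
  qed
  then have "real ((i + 1)\<^sup>2 div 4) * Min ?M \<le> real ((i + 1)\<^sup>2 div 4) * (1/2)"
    using minB by (intro mult_left_mono) auto
  also have "\<dots> \<le> Max (?rep A ` A_simple_roots)" using maxA by simp
  finally have "real ((i + 1)\<^sup>2 div 4) \<le> A_R_pair A B"
    unfolding type_A.R_pair_def using \<open>0 < Min ?M\<close> by (subst pos_le_divide_eq) auto
  then show ?thesis using le by simp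
qed

text \<open>From i = 2 on, \<open>R_dim_ge\<close> and positivity of the list turn suitability into
  growth; at i = 1 the extension by 0 leaves only the positivity of
  \<open>\<epsilon> 1\<close>.\<close>

lemma suitable_imp_growth:
  assumes suit: "A_suitable_list (A_max_building_set :: (real, 'n) vec set set) \<epsilon> a"
  shows "growth n (\<lambda>i. if i = 0 then 0 else \<epsilon> i)"
proof
  have dim: "dim (A_space :: (real, 'n) vec set) = n - 1" using dim_A_space n by simp
  have pos: "0 < \<epsilon> i" if "1 \<le> i" "i < n" for i
    using that
  proof (induction i)
    case (Suc i)
    show ?case
    proof (cases "i = 0")
      case False
      then have "\<epsilon> i < \<epsilon> (Suc i)"
        using suit Suc.prems unfolding type_A.suitable_list_def dim by (auto dest!: bspec[of _ _ "Suc i"])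
      then show ?thesis using Suc False by simp
    qed (use suit in \<open>auto simp: type_A.suitable_list_def\<close>)
  qed simp
  fix i assume i: "1 \<le> i" "i < n"
  show "2 * real ((i + 1)\<^sup>2 div 4) * (if i - 1 = 0 then 0 else \<epsilon> (i - 1)) < (if i = 0 then 0 else \<epsilon> i)"
  proof (cases "i = 1")
    case False
    then have i2: "2 \<le> i" using i by simp
    then have "2 * real ((i + 1)\<^sup>2 div 4) * \<epsilon> (i - 1) \<le>
        2 * A_R_dim (A_max_building_set :: (real, 'n) vec set set) i (i - 1) * \<epsilon> (i - 1)"
      using R_dim_ge[OF i2 i(2)] less_imp_le[OF pos[of "i - 1"]] i i2 by (intro mult_right_mono) auto
    also have "\<dots> < \<epsilon> i" using suit i i2 unfolding type_A.suitable_list_def dim by auto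
    finally show ?thesis using i2 by simp
  qed (use pos[OF i] in simp)
qed simp

end

theorem theorem9p3:
  fixes P :: "(real ^ 'n::{finite,linorder}) set"
    and n k :: nat and \<epsilon> :: "nat \<Rightarrow> real" and a :: real
  assumes "n = CARD('n)" and "n \<ge> 2"
    and "A_suitable_list (A_max_building_set :: (real ^ 'n::{finite,linorder}) set set) \<epsilon> a"
    and "P = A_permutonestohedron A_max_building_set \<epsilon> a"
    and "k \<le> n - 2"
  shows "real (card (faces_of_codim P (k + 1))) =
    (\<Sum>\<mu>\<in>{\<mu> \<in> partitions n. length \<mu> \<ge> 2 + k}.
       part_weight \<mu> * (fact n / (\<Prod>i<length \<mu>. fact (\<mu> ! i))) *
       (\<Sum>js\<in>index_seqs k (length \<mu>).
          \<Prod>i<k. real (((js @ [length \<mu>]) ! (i + 1) - 1) choose (js ! i - 1))))"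
proof -
  obtain e :: "nat \<Rightarrow> 'n" where e: "bij_betw e {..<n} UNIV" and mono: "\<And>i j. i < j \<Longrightarrow> j < n \<Longrightarrow> e i < e j"
    using monotone_enumeration[where 'n = 'n] assms(1) by metis
  let ?\<eta> = "\<lambda>i. if i = 0 then 0 else \<epsilon> i"
  have growth: "growth CARD('n) ?\<eta>"
    using suitable_imp_growth[OF assms(1) e mono assms(3)] assms(1) by simp
  have "\<epsilon> (n - 1) = a"
    using assms(3) dim_A_space[where 'n = 'n] assms(1) by (simp add: type_A.suitable_list_def)
  then have "P = chain_polytope ?\<eta>"
    unfolding assms(4) using assms(2) by (intro permutonestohedron_eq[OF assms(1) e mono]) auto
  moreover have "k + 1 \<le> CARD('n) - 1" using assms(1,2,5) by simp
  ultimately have "card (faces_of_codim P (k + 1)) = (\<Sum>m\<in>{1..<n}. chain_count n m * chain_count m k)"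
    using card_faces_chain_polytope[OF growth, of k] assms(1) by simp
  then show ?thesis using partition_sum_eq[OF assms(2), of k] by simp
qed

end
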